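(* Let $\gamma>1$. Let $T\colon M\to M$ be modelled by a two-sided Young tower and suppose that $T$ satisfies the Functional Correlation Bound with rate $n^{-\gamma}$. For mean zero $v,w\in\mathcal H(M)$ define $$S_v(n)=\sum_{0\le i<n}v\circ T^i,\qquad \mathbb S_{v,w}(n)=\sum_{0\le i<j<n}(v\circ T^i)\,(w\circ T^j).$$ Then there exists a constant $C>0$ such that for all $n\ge1$ and all mean zero $v,w\in\mathcal H(M)$: (a) $|S_v(n)|_{2\gamma}\le Cn^{1/2}\|v\|_{\mathcal H}$; (b) $|\mathbb S_{v,w}(n)|_{\gamma}\le Cn\|v\|_{\mathcal H}\|w\|_{\mathcal H}$. Here $|\cdot|_p$ denotes the $L^p(\mu)$ norm, and mean zero means $\int_Mv\,d\mu=0$.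
   Context: **Full-branch Gibbs–Markov maps.** Let $(\bar Y,\bar\mu_Y)$ be a probability space, $\bar F\colon\bar Y\to\bar Y$ ergodic and measure-preserving, and $\alpha$ an at most countable measurable partition of $\bar Y$. $\bar F$ is a full-branch Gibbs–Markov map if there are constants $K>0$, $\theta_0\in(0,1)$ such that for all $a\in\alpha$: (1) $\bar F|_a\colon a\to\bar Y$ is a measurable bijection; (2) for all distinct $y,y'\in\bar Y$ the separation time $s(y,y')=\inf\{n\ge0:\bar F^ny,\bar F^ny'\text{ lie in distinct elements of }\alpha\}$ is finite; (3) with $\zeta\colon a\to\mathbb R^+$, $\zeta=d\bar\mu_Y/d\big((\bar F|_a^{-1})_*\bar\mu_Y\big)$, one has $|\log\zeta(y)-\log\zeta(y')|\le K\theta_0^{s(y,y')}$ for all $y,y'\in a$. **Two-sided Gibbs–Markov maps.** Let $(Y,d)$ be a bounded metric space with Borel probability measure $\mu_Y$ and $F\colon Y\to Y$ ergodic and measure-preserving. $F$ is a two-sided Gibbs–Markov map if there is a full-branch Gibbs–Markov map $\bar F\colon\bar Y\to\bar Y$ and a measure-preserving semiconjugacy $\bar\pi\colon Y\to\bar Y$ ($\bar\pi\circ F=\bar F\circ\bar\pi$, $\bar\pi_*\mu_Y=\bar\mu_Y$) such that, setting $s(y,y')=s(\bar\pi y,\bar\pi y')$ (equal to $\infty$ if $\bar\pi y=\bar\pi y'$, with $\theta^\infty=0$), $d(F^ny,F^ny')\le K(\theta_0^n+\theta_0^{s(y,y')-n})$ for all $y,y'\in Y$, $n\ge0$. **Young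 towers.** Let $\phi\colon Y\to\mathbb Z^+$ be integrable and constant on $\bar\pi^{-1}a$ for each $a\in\alpha$. The two-sided tower is $\Delta=\{(y,\ell)\in Y\times\mathbb Z:0\le\ell<\phi(y)\}$ with $f(y,\ell)=(y,\ell+1)$ if $\ell<\phi(y)-1$, $f(y,\ell)=(Fy,0)$ if $\ell=\phi(y)-1$, and $f$-invariant probability measure $\mu_\Delta=(\mu_Y\times\text{counting})/\int_Y\phi\,d\mu_Y$. **Modelled by a Young tower.** $(M,\mu)$ is a bounded metric space with Borel probability measure $\mu$, and $T\colon M\to M$ is ergodic and measure-preserving. $T$ is modelled by a (two-sided) Young tower if there is a measurable $Y\subset M$ with $\mu(Y)>0$ and an integrable function $\phi\colon Y\to\mathbb Z^+$ such that $F=T^\phi\colon Y\to Y$ is a two-sided Gibbs–Markov map with respect to some probability measure $\mu_Y$ (and some bounded metric $d$ on $Y$), $\phi$ is constant on $\bar\pi^{-1}a$ for each $a\in\alpha$ (with $\bar\pi$ and $\alpha$ the semiconjugacy and partition associated with $F$), and $\pi_M\colon\Delta\to M$, $\pi_M(y,\ell)=T^\ell y$, is a measure-preserving semiconjugacy ($\pi_M\circ f=T\circ\pi_M$, $(\pi_M)_*\mu_\Delta=\mu$). **Dynamically Hölder observables.** Fix $\theta\in(0,1)$. For $v\colon M\to\mathbb R$ set $$[v]_{\mathcal H}=\sup_{y,y'\in Y,\,y\ne y'}\ \sup_{0\le\ell<\phi(y)}\frac{|v(T^\ell y)-v(T^\ell y')|}{d(y,y')+\theta^{s(y,y')}},\quad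 |v|_\infty=\sup_M|v|,\quad \|v\|_{\mathcal H}=|v|_\infty+[v]_{\mathcal H},$$ and let $\mathcal H(M)$ be the set of $v$ with $\|v\|_{\mathcal H}<\infty$. For $G\colon M^q\to\mathbb R$ and $0\le i<q$ set $[G]_{\mathcal H,i}=\sup_{x_0,\dots,x_{q-1}\in M}[G(x_0,\dots,x_{i-1},\cdot,x_{i+1},\dots,x_{q-1})]_{\mathcal H}$. Write $G\in\mathcal{SH}_q(M)$ if $|G|_\infty+\sum_{i=0}^{q-1}[G]_{\mathcal H,i}<\infty$. Functions are assumed measurable so that all integrals make sense. **Functional Correlation Bound.** $T$ satisfies the Functional Correlation Bound with rate $n^{-\gamma}$ if there is a constant $C>0$ such that for all integers $1\le p<q$, all integers $0\le n_0\le\cdots\le n_{q-1}$ with $n_{p-1}<n_p$, and all $G\in\mathcal{SH}_q(M)$, $$\Big|\int_M G(T^{n_0}x,\dots,T^{n_{q-1}}x)\,d\mu(x)-\int_{M^2}G(T^{n_0}x_0,\dots,T^{n_{p-1}}x_0,T^{n_p}x_1,\dots,T^{n_{q-1}}x_1)\,d\mu(x_0)d\mu(x_1)\Big|\le C(n_p-n_{p-1})^{-\gamma}\Big(|G|_\infty+\sum_{i=0}^{q-1}[G]_{\mathcal H,i}\Big).$$ *)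

theory Defs
  imports "HOL-Probability.Probability"
begin

section \<open>Measure-preserving maps\<close>

definition preserves_measure :: "'a measure \<Rightarrow> 'b measure \<Rightarrow> ('a \<Rightarrow> 'b) \<Rightarrow> bool" where
  "preserves_measure M N h \<longleftrightarrow> h \<in> measurable M N \<and> distr M N h = N"

definition ergodic_mpt :: "'a measure \<Rightarrow> ('a \<Rightarrow> 'a) \<Rightarrow> bool" where
  "ergodic_mpt M F \<longleftrightarrow> preserves_measure M M F \<and>
     (\<forall>A\<in>sets M. F -` A \<inter> space M = A \<longrightarrow> emeasure M A = 0 \<or> emeasure M (space M - A) = 0)"

section \<open>Gibbs--Markov maps\<close>

text \<open>The value is \<open>\<infinity>\<close> if the orbits are never separated, in particular if \<open>y = y'\<close>.\<close>

definition separation_time :: "('b \<Rightarrow> 'b) \<Rightarrow> 'b set set \<Rightarrow> 'b \<Rightarrow> 'b \<Rightarrow> enat" where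
  "separation_time F \<alpha> y y' =
     Inf {enat n | n. \<exists>a\<in>\<alpha>. \<exists>a'\<in>\<alpha>. a \<noteq> a' \<and> (F ^^ n) y \<in> a \<and> (F ^^ n) y' \<in> a'}"

text \<open>\<open>epow \<theta> s n\<close> is \<open>\<theta>\<close> to the power \<open>s - n\<close>, where the exponent may be a negative integer,
  and \<open>\<theta>\<close> to the power \<open>\<infinity>\<close> is \<open>0\<close>.\<close>

definition epow :: "real \<Rightarrow> enat \<Rightarrow> nat \<Rightarrow> real" where
  "epow \<theta> s n = (case s of enat m \<Rightarrow> \<theta> powi (int m - int n) | \<infinity> \<Rightarrow> 0)"

text \<open>The constants \<open>K\<close> and \<open>\<theta>\<^sub>0\<close> are parameters because a two-sided Gibbs--Markov map shares them
  with its quotient; they are existentially quantified in the definition of a map modelled by a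
  Young tower. The density \<open>\<zeta>\<close> is a version of the Radon--Nikodym derivative
  for which the distortion bound holds at every point. The push-forward under the inverse branch
  only makes sense if that inverse is measurable.\<close>

definition full_branch_gibbs_markov ::
    "real \<Rightarrow> real \<Rightarrow> 'b measure \<Rightarrow> ('b \<Rightarrow> 'b) \<Rightarrow> 'b set set \<Rightarrow> bool" where
  "full_branch_gibbs_markov K \<theta>\<^sub>0 N F \<alpha> \<longleftrightarrow>
     K > 0 \<and> 0 < \<theta>\<^sub>0 \<and> \<theta>\<^sub>0 < 1 \<and>
     prob_space N \<and> ergodic_mpt N F \<and>
     countable \<alpha> \<and> \<alpha> \<subseteq> sets N \<and> partition_on (space N) \<alpha> \<and>
     (\<forall>a\<in>\<alpha>. bij_betw F a (space N) \<and>
             the_inv_into a F \<in> measurable N (restrict_space N a)) \<and>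
     (\<forall>y\<in>space N. \<forall>y'\<in>space N. y \<noteq> y' \<longrightarrow> separation_time F \<alpha> y y' < \<infinity>) \<and>
     (\<forall>a\<in>\<alpha>. \<exists>\<zeta> :: 'b \<Rightarrow> real.
        \<zeta> \<in> borel_measurable (restrict_space N a) \<and> (\<forall>y\<in>a. \<zeta> y > 0) \<and>
        density (distr N (restrict_space N a) (the_inv_into a F)) (\<lambda>y. ennreal (\<zeta> y))
          = restrict_space N a \<and>
        (\<forall>y\<in>a. \<forall>y'\<in>a. \<bar>ln (\<zeta> y) - ln (\<zeta> y')\<bar> \<le> K * epow \<theta>\<^sub>0 (separation_time F \<alpha> y y') 0))"

definition two_sided_gibbs_markov ::
    "real \<Rightarrow> real \<Rightarrow> 'a set \<Rightarrow> ('a \<Rightarrow> 'a \<Rightarrow> real) \<Rightarrow> 'a measure \<Rightarrow> ('a \<Rightarrow> 'a) \<Rightarrow>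
     'b measure \<Rightarrow> ('b \<Rightarrow> 'b) \<Rightarrow> 'b set set \<Rightarrow> ('a \<Rightarrow> 'b) \<Rightarrow> bool" where
  "two_sided_gibbs_markov K \<theta>\<^sub>0 Y d \<mu>Y F N Fbar \<alpha> \<pi> \<longleftrightarrow>
     Metric_space Y d \<and> Metric_space.mbounded Y d Y \<and>
     prob_space \<mu>Y \<and> space \<mu>Y = Y \<and>
     sets \<mu>Y = sigma_sets Y {U. openin (Metric_space.mtopology Y d) U} \<and>
     ergodic_mpt \<mu>Y F \<and>
     full_branch_gibbs_markov K \<theta>\<^sub>0 N Fbar \<alpha> \<and>
     preserves_measure \<mu>Y N \<pi> \<and> (\<forall>y\<in>Y. \<pi> (F y) = Fbar (\<pi> y)) \<and>
     (\<forall>y\<in>Y. \<forall>y'\<in>Y. \<forall>n. d ((F ^^ n) y) ((F ^^ n) y')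
        \<le> K * (\<theta>\<^sub>0 ^ n + epow \<theta>\<^sub>0 (separation_time Fbar \<alpha> (\<pi> y) (\<pi> y')) n))"

section \<open>Young towers\<close>

definition tower :: "'a set \<Rightarrow> ('a \<Rightarrow> nat) \<Rightarrow> ('a \<times> nat) set" where
  "tower Y \<phi> = {(y, l). y \<in> Y \<and> l < \<phi> y}"

definition tower_map :: "('a \<Rightarrow> 'a) \<Rightarrow> ('a \<Rightarrow> nat) \<Rightarrow> 'a \<times> nat \<Rightarrow> 'a \<times> nat" where
  "tower_map F \<phi> = (\<lambda>(y, l). if l < \<phi> y - 1 then (y, l + 1) else (F y, 0))"

definition tower_measure :: "'a measure \<Rightarrow> ('a \<Rightarrow> nat) \<Rightarrow> ('a \<times> nat) measure" where
  "tower_measure \<mu>Y \<phi> =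
     scale_measure (ennreal (1 / (\<integral>y. real (\<phi> y) \<partial>\<mu>Y)))
       (restrict_space (\<mu>Y \<Otimes>\<^sub>M count_space UNIV) (tower (space \<mu>Y) \<phi>))"

text \<open>The data of a tower: base, return time, metric and measure on the base, and the quotient
  Gibbs--Markov map (on the probability space \<open>quot_measure\<close>) with its partition and
  semiconjugacy. The phase space of \<open>T\<close> is the type \<open>'m\<close>.\<close>

record ('m, 'b) tower_data =
  base :: "'m set"
  ret :: "'m \<Rightarrow> nat"
  base_dist :: "'m \<Rightarrow> 'm \<Rightarrow> real"
  base_measure :: "'m measure"
  quot_measure :: "'b measure"
  quot_map :: "'b \<Rightarrow> 'b"
  quot_partition :: "'b set set"
  quot_proj :: "'m \<Rightarrow> 'b"

definition induced_map :: "('m \<Rightarrow> 'm) \<Rightarrow> ('m \<Rightarrow> nat) \<Rightarrow> 'm \<Rightarrow> 'm" where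
  "induced_map T \<phi> y = (T ^^ \<phi> y) y"

definition tower_proj :: "('m \<Rightarrow> 'm) \<Rightarrow> 'm \<times> nat \<Rightarrow> 'm" where
  "tower_proj T = (\<lambda>(y, l). (T ^^ l) y)"

definition modelled_by_young_tower ::
    "'m::metric_space measure \<Rightarrow> ('m \<Rightarrow> 'm) \<Rightarrow> ('m, 'b) tower_data \<Rightarrow> bool" where
  "modelled_by_young_tower \<mu> T D \<longleftrightarrow>
     bounded (UNIV :: 'm set) \<and> prob_space \<mu> \<and> sets \<mu> = sets borel \<and> ergodic_mpt \<mu> T \<and>
     base D \<in> sets \<mu> \<and> emeasure \<mu> (base D) > 0 \<and>
     (\<forall>y\<in>base D. ret D y \<ge> 1) \<and>
     integrable (base_measure D) (\<lambda>y. real (ret D y)) \<and>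
     (\<exists>K \<theta>\<^sub>0. two_sided_gibbs_markov K \<theta>\<^sub>0 (base D) (base_dist D) (base_measure D)
        (induced_map T (ret D)) (quot_measure D) (quot_map D) (quot_partition D) (quot_proj D)) \<and>
     (\<forall>a\<in>quot_partition D. ret D constant_on (quot_proj D -` a \<inter> base D)) \<and>
     (\<forall>z\<in>tower (base D) (ret D).
        tower_proj T (tower_map (induced_map T (ret D)) (ret D) z) = T (tower_proj T z)) \<and>
     preserves_measure (tower_measure (base_measure D) (ret D)) \<mu> (tower_proj T)"

section \<open>Dynamically Hoelder observables\<close>

definition base_sep :: "('m, 'b) tower_data \<Rightarrow> 'm \<Rightarrow> 'm \<Rightarrow> enat" where
  "base_sep D y y' = separation_time (quot_map D) (quot_partition D) (quot_proj D y) (quot_proj D y')"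

definition hoelder_seminorm ::
    "('m \<Rightarrow> 'm) \<Rightarrow> ('m, 'b) tower_data \<Rightarrow> real \<Rightarrow> ('m \<Rightarrow> real) \<Rightarrow> ennreal" where
  "hoelder_seminorm T D \<theta> v =
     (SUP y\<in>base D. SUP y'\<in>base D - {y}. SUP l\<in>{..<ret D y}.
        ennreal (\<bar>v ((T ^^ l) y) - v ((T ^^ l) y')\<bar> / (base_dist D y y' + epow \<theta> (base_sep D y y') 0)))"

definition sup_norm_on :: "'a set \<Rightarrow> ('a \<Rightarrow> real) \<Rightarrow> ennreal" where
  "sup_norm_on A v = (SUP x\<in>A. ennreal \<bar>v x\<bar>)"

definition hoelder_norm ::
    "('m \<Rightarrow> 'm) \<Rightarrow> ('m, 'b) tower_data \<Rightarrow> real \<Rightarrow> ('m \<Rightarrow> real) \<Rightarrow> ennreal" where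
  "hoelder_norm T D \<theta> v = sup_norm_on UNIV v + hoelder_seminorm T D \<theta> v"

definition hoelder_space ::
    "'m measure \<Rightarrow> ('m \<Rightarrow> 'm) \<Rightarrow> ('m, 'b) tower_data \<Rightarrow> real \<Rightarrow> ('m \<Rightarrow> real) set" where
  "hoelder_space \<mu> T D \<theta> = {v \<in> borel_measurable \<mu>. hoelder_norm T D \<theta> v < \<infinity>}"

text \<open>Points of the \<open>q\<close>-fold power of \<open>'m\<close> are the extensional functions on \<open>{..<q}\<close>, as in the
  library's product measures.\<close>

definition sep_hoelder_seminorm ::
    "('m \<Rightarrow> 'm) \<Rightarrow> ('m, 'b) tower_data \<Rightarrow> real \<Rightarrow> nat \<Rightarrow> ((nat \<Rightarrow> 'm) \<Rightarrow> real) \<Rightarrow> nat \<Rightarrow> ennreal" where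
  "sep_hoelder_seminorm T D \<theta> q G i =
     (SUP x\<in>(\<Pi>\<^sub>E j\<in>{..<q}. UNIV). hoelder_seminorm T D \<theta> (\<lambda>z. G (x(i := z))))"

definition sep_hoelder_norm ::
    "('m \<Rightarrow> 'm) \<Rightarrow> ('m, 'b) tower_data \<Rightarrow> real \<Rightarrow> nat \<Rightarrow> ((nat \<Rightarrow> 'm) \<Rightarrow> real) \<Rightarrow> ennreal" where
  "sep_hoelder_norm T D \<theta> q G =
     sup_norm_on (\<Pi>\<^sub>E j\<in>{..<q}. UNIV) G + (\<Sum>i<q. sep_hoelder_seminorm T D \<theta> q G i)"

definition sep_hoelder_space ::
    "'m measure \<Rightarrow> ('m \<Rightarrow> 'm) \<Rightarrow> ('m, 'b) tower_data \<Rightarrow> real \<Rightarrow> nat \<Rightarrow> ((nat \<Rightarrow> 'm) \<Rightarrow> real) set" where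
  "sep_hoelder_space \<mu> T D \<theta> q =
     {G \<in> borel_measurable (\<Pi>\<^sub>M j\<in>{..<q}. \<mu>). sep_hoelder_norm T D \<theta> q G < \<infinity>}"

definition functional_correlation_bound ::
    "'m measure \<Rightarrow> ('m \<Rightarrow> 'm) \<Rightarrow> ('m, 'b) tower_data \<Rightarrow> real \<Rightarrow> real \<Rightarrow> bool" where
  "functional_correlation_bound \<mu> T D \<theta> \<gamma> \<longleftrightarrow>
     (\<exists>C>0. \<forall>p q. \<forall>n :: nat \<Rightarrow> nat. \<forall>G\<in>sep_hoelder_space \<mu> T D \<theta> q.
        1 \<le> p \<longrightarrow> p < q \<longrightarrow> mono_on {..<q} n \<longrightarrow> n (p - 1) < n p \<longrightarrow>
        ennreal \<bar>(\<integral>x. G (\<lambda>i\<in>{..<q}. (T ^^ n i) x) \<partial>\<mu>)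
               - (\<integral>(x\<^sub>0, x\<^sub>1). G (\<lambda>i\<in>{..<q}. (T ^^ n i) (if i < p then x\<^sub>0 else x\<^sub>1)) \<partial>(\<mu> \<Otimes>\<^sub>M \<mu>))\<bar>
          \<le> ennreal (C * real (n p - n (p - 1)) powr (- \<gamma>)) * sep_hoelder_norm T D \<theta> q G)"

section \<open>Norms and Birkhoff sums\<close>

text \<open>The \<open>L\<^sup>p\<close> norm, with value \<open>\<infinity>\<close> when the integral diverges.\<close>

definition Lp_norm :: "'a measure \<Rightarrow> real \<Rightarrow> ('a \<Rightarrow> real) \<Rightarrow> ennreal" where
  "Lp_norm M p f =
     (let I = (\<integral>\<^sup>+x. ennreal (\<bar>f x\<bar> powr p) \<partial>M)
      in if I = \<infinity> then \<infinity> else ennreal (enn2real I powr (1 / p)))"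

definition mean_zero_hoelder ::
    "'m measure \<Rightarrow> ('m \<Rightarrow> 'm) \<Rightarrow> ('m, 'b) tower_data \<Rightarrow> real \<Rightarrow> ('m \<Rightarrow> real) set" where
  "mean_zero_hoelder \<mu> T D \<theta> = {v \<in> hoelder_space \<mu> T D \<theta>. (\<integral>x. v x \<partial>\<mu>) = 0}"

definition birkhoff_sum :: "('m \<Rightarrow> 'm) \<Rightarrow> ('m \<Rightarrow> real) \<Rightarrow> nat \<Rightarrow> 'm \<Rightarrow> real" where
  "birkhoff_sum T v n x = (\<Sum>i<n. v ((T ^^ i) x))"

definition iterated_sum :: "('m \<Rightarrow> 'm) \<Rightarrow> ('m \<Rightarrow> real) \<Rightarrow> ('m \<Rightarrow> real) \<Rightarrow> nat \<Rightarrow> 'm \<Rightarrow> real" where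
  "iterated_sum T v w n x = (\<Sum>(i, j)\<in>{(i, j). i < j \<and> j < n}. v ((T ^^ i) x) * w ((T ^^ j) x))"

end

theory Submission
  imports Defs
begin

text \<open>Cut \<open>{0..<n}\<close> into \<open>2k\<close> blocks of length \<open>m = n div 2k\<close> and treat the even and the odd blocks
  separately, so that consecutive blocks are separated by gaps of length \<open>m\<close>. Applied to the \<open>p\<close>-th
  power of the sum over the past blocks plus the next block, the functional correlation bound replaces
  the next block by an independent copy. The norm of this observable grows like \<open>m\<close> to the power \<open>2\<gamma>\<close>
  in both cases (\<open>p = 2\<gamma>\<close> for Birkhoff sums, \<open>p = \<gamma>\<close> for iterated sums), so the error is of the target
  order \<open>m powr \<gamma>\<close>. For an independent centred summand \<open>b\<close>, expanding \<open>\<bar>a + b\<bar> powr p\<close> to second order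
  shows that the \<open>p\<close>-th moment increases by at most a constant (not depending on \<open>k\<close>) times the
  \<open>p\<close>-th moment of \<open>b\<close>, up to a factor \<open>1 + 1/k\<close> and a term controlled by the variance. The moments
  \<open>b n\<close> therefore satisfy \<open>b n \<le> C k b (n div 2k) + E k n powr \<gamma>\<close>, and since \<open>\<gamma> > 1\<close> this recursion
  closes once \<open>k\<close> is large. The products of Birkhoff sums over different blocks that occur in an
  iterated sum are bounded through the moments of Birkhoff sums.\<close>

section \<open>Real inequalities\<close>

text \<open>The obstacle is the dependence on \<open>k\<close>. Estimating a sum of \<open>k\<close>
  blocks by the triangle inequality costs \<open>k powr p\<close>, and against the gain
  \<open>(n / k) powr \<gamma>\<close> nothing remains, since \<open>p \<ge> \<gamma>\<close>. A
  factor linear in \<open>k\<close> leaves \<open>k powr (1 - \<gamma>)\<close>, which is small for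
  large \<open>k\<close>. Linearity comes from cancellation: the first order term vanishes for an
  independent centred summand, and a loss of \<open>1 + 1/k\<close> in each of at most
  \<open>k\<close> steps costs at most a factor \<open>exp 1\<close>. For \<open>p > 2\<close> the
  second order term leaves a variance, so variances have to be known beforehand. For Birkhoff sums
  they are linear in \<open>n\<close>, because covariances decay at the rate
  \<open>\<gamma> > 1\<close> and are summable. An iterated sum has to be centred; its mean is
  linear in \<open>n\<close> for the same reason. The variance of the centred sum comes from running
  the argument with exponent 2, where the quadratic term is itself the \<open>p\<close>-th power,
  before it is run with \<open>\<gamma>\<close>.\<close>

text \<open>The mean value theorem on the half line and the reverse triangle inequality. It supplies
  the oscillation constant of a \<open>p\<close>-th power in
  \<open>decorrelate_moment\<close>.\<close>

lemma abs_powr_lipschitz: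
  fixes x y B p :: real
  assumes "p \<ge> 1" "\<bar>x\<bar> \<le> B" "\<bar>y\<bar> \<le> B"
  shows "\<bar>\<bar>x\<bar> powr p - \<bar>y\<bar> powr p\<bar> \<le> p * B powr (p - 1) * \<bar>x - y\<bar>"
proof -
  have main: "t powr p - s powr p \<le> p * B powr (p - 1) * (t - s)"
    if st: "0 \<le> s" "s < t" "t \<le> B" for s t :: real
  proof -
    \<comment> \<open>The derivative is required only in the interior of the interval, so
      \<open>s = 0\<close> is allowed.\<close>
    have "continuous_on {s..t} (\<lambda>u. u powr p)"
      using st assms by (intro continuous_on_powr' continuous_intros) auto
    moreover have "((\<lambda>u. u powr p) has_derivative (\<lambda>h. h * (p * u powr (p - 1)))) (at u)"
      if "s < u" for u
      using that st has_real_derivative_powr[of u p]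
      by (simp add: has_field_derivative_def mult_commute_abs)
    ultimately have "\<exists>z>s. z < t \<and> t powr p - s powr p = (t - s) * (p * z powr (p - 1))"
      using mvt[OF st(2), of "\<lambda>u. u powr p" "\<lambda>u h. h * (p * u powr (p - 1))"] by metis
    then obtain z where z: "s < z" "z < t" "t powr p - s powr p = (t - s) * (p * z powr (p - 1))"
      by blast
    have "z powr (p - 1) \<le> B powr (p - 1)" using z st assms by (intro powr_mono2) auto
    then have "(t - s) * (p * z powr (p - 1)) \<le> (t - s) * (p * B powr (p - 1))"
      using st assms by (intro mult_left_mono) auto
    then show ?thesis using z by (simp add: algebra_simps)
  qed
  have pB: "0 \<le> p * B powr (p - 1)" using assms by auto
  have "\<bar>\<bar>x\<bar> powr p - \<bar>y\<bar> powr p\<bar> \<le> p * B powr (p - 1) * \<bar>\<bar>x\<bar> - \<bar>y\<bar>\<bar>"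
  proof (cases "\<bar>x\<bar>" "\<bar>y\<bar>" rule: linorder_cases)
    case less
    have "\<bar>x\<bar> powr p \<le> \<bar>y\<bar> powr p" using less assms by (intro powr_mono2) auto
    then show ?thesis using main[of "\<bar>x\<bar>" "\<bar>y\<bar>"] less assms by auto
  next
    case greater
    have "\<bar>y\<bar> powr p \<le> \<bar>x\<bar> powr p" using greater assms by (intro powr_mono2) auto
    then show ?thesis using main[of "\<bar>y\<bar>" "\<bar>x\<bar>"] greater assms by auto
  qed auto
  also have "\<dots> \<le> p * B powr (p - 1) * \<bar>x - y\<bar>" using pB by (intro mult_left_mono) auto
  finally show ?thesis .
qed

lemma abs_powr_add_le:
  fixes a b p :: real
  assumes "p \<ge> 0"
  shows "\<bar>a + b\<bar> powr p \<le> 2 powr p * (\<bar>a\<bar> powr p + \<bar>b\<bar> powr p)"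
proof -
  have "\<bar>a + b\<bar> powr p \<le> (2 * max \<bar>a\<bar> \<bar>b\<bar>) powr p" using assms by (intro powr_mono2) auto
  also have "\<dots> = 2 powr p * max \<bar>a\<bar> \<bar>b\<bar> powr p" by (simp add: powr_mult)
  also have "\<dots> \<le> 2 powr p * (\<bar>a\<bar> powr p + \<bar>b\<bar> powr p)"
    by (intro mult_left_mono) (auto simp: max_def)
  finally show ?thesis .
qed

text \<open>Every summand is replaced by the largest one. The loss of \<open>card I powr p\<close>
  is affordable only in remainders, whose constants may depend on the number of blocks in any
  way.\<close>

lemma abs_powr_sum_le:
  fixes f :: "'a \<Rightarrow> real" and p :: real
  assumes "finite I" "p \<ge> 0"
  shows "\<bar>\<Sum>i\<in>I. f i\<bar> powr p \<le> real (card I) powr p * (\<Sum>i\<in>I. \<bar>f i\<bar> powr p)"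
proof (cases "I = {}")
  case False
  define m where "m = Max ((\<lambda>i. \<bar>f i\<bar>) ` I)"
  have m: "\<bar>f i\<bar> \<le> m" if "i \<in> I" for i using that assms by (auto simp: m_def)
  have "m \<in> (\<lambda>i. \<bar>f i\<bar>) ` I" unfolding m_def using False assms by (intro Max_in) auto
  then obtain j where j: "j \<in> I" "m = \<bar>f j\<bar>" by auto
  have "\<bar>\<Sum>i\<in>I. f i\<bar> \<le> (\<Sum>i\<in>I. \<bar>f i\<bar>)" by (rule sum_abs)
  also have "\<dots> \<le> real (card I) * m" using sum_bounded_above[of I "\<lambda>i. \<bar>f i\<bar>" m] m by auto
  finally have "\<bar>\<Sum>i\<in>I. f i\<bar> powr p \<le> (real (card I) * m) powr p"
    using assms by (intro powr_mono2) auto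
  also have "\<dots> = real (card I) powr p * \<bar>f j\<bar> powr p" using j by (simp add: powr_mult)
  also have "\<dots> \<le> real (card I) powr p * (\<Sum>i\<in>I. \<bar>f i\<bar> powr p)"
    using j assms by (intro mult_left_mono member_le_sum) auto
  finally show ?thesis .
qed simp

text \<open>The mean value theorem is applied twice, to the exponents \<open>p\<close> and
  \<open>p - 1\<close>. The intermediate point stays comparable to \<open>a\<close>, so that
  \<open>z powr (p - 2)\<close> can be bounded for either sign of \<open>p - 2\<close>.\<close>

lemma powr_second_order:
  fixes a b p :: real
  assumes "p > 1" "a > 0" "\<bar>b\<bar> < a / 2"
  obtains z where "a / 2 \<le> z" "z \<le> 2 * a"
    "(a + b) powr p \<le> a powr p + p * a powr (p - 1) * b + p * (p - 1) * z powr (p - 2) * b\<^sup>2"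
proof -
  have *: "\<exists>z. a / 2 \<le> z \<and> z \<le> 2 * a \<and> \<bar>z - a\<bar> \<le> \<bar>c\<bar> \<and> (a + c) powr q - a powr q = c * (q * z powr (q - 1))"
    if "\<bar>c\<bar> < a / 2" for c q :: real
  proof (cases "c" "0 :: real" rule: linorder_cases)
    case less
    have "\<exists>z>a + c. z < a \<and> a powr q - (a + c) powr q = (a - (a + c)) * (q * z powr (q - 1))"
      using less that by (intro MVT2) (auto intro!: derivative_eq_intros)
    then obtain z where "z>a + c" "z < a" "a powr q - (a + c) powr q = (a - (a + c)) * (q * z powr (q - 1))" by auto
    then show ?thesis using that less by (intro exI[of _ z]) (auto simp: abs_if)
  next
    case greater
    have "\<exists>z>a. z < a + c \<and> (a + c) powr q - a powr q = ((a + c) - a) * (q * z powr (q - 1))"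
      using greater that assms by (intro MVT2) (auto intro!: derivative_eq_intros)
    then obtain z where "z>a" "z < a + c" "(a + c) powr q - a powr q = ((a + c) - a) * (q * z powr (q - 1))" by auto
    then show ?thesis using that greater by (intro exI[of _ z]) (auto simp: abs_if)
  qed (use assms in \<open>auto intro: exI[of _ a]\<close>)
  obtain z where z: "\<bar>z - a\<bar> \<le> \<bar>b\<bar>" "(a + b) powr p - a powr p = b * (p * z powr (p - 1))"
    using *[OF assms(3), of p] by blast
  \<comment> \<open>The intermediate point of the first application is at distance at most
    \<open>\<bar>b\<bar>\<close> from \<open>a\<close>, hence \<open>z - a\<close> is an admissible
    increment for the second one.\<close>
  have "\<bar>z - a\<bar> < a / 2" using z assms by linarith
  from *[OF this, of "p - 1"] obtain t where t: "a / 2 \<le> t" "t \<le> 2 * a"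
    "z powr (p - 1) - a powr (p - 1) = (z - a) * ((p - 1) * t powr (p - 2))" by auto
  have "b * (z - a) \<le> \<bar>b\<bar> * \<bar>z - a\<bar>" by (metis abs_ge_self abs_mult)
  also have "\<dots> \<le> \<bar>b\<bar> * \<bar>b\<bar>" using z by (intro mult_left_mono) auto
  finally have "b * (z - a) * (p * (p - 1) * t powr (p - 2)) \<le> b\<^sup>2 * (p * (p - 1) * t powr (p - 2))"
    using assms by (intro mult_right_mono) (auto simp: power2_eq_square)
  moreover have "(a + b) powr p = a powr p + p * a powr (p - 1) * b + b * (z - a) * (p * (p - 1) * t powr (p - 2))"
  proof -
    have "z powr (p - 1) = a powr (p - 1) + (z - a) * ((p - 1) * t powr (p - 2))" using t by simp
    then have "(a + b) powr p = a powr p + b * (p * (a powr (p - 1) + (z - a) * ((p - 1) * t powr (p - 2))))"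
      using z by simp
    then show ?thesis by (simp add: algebra_simps)
  qed
  ultimately show ?thesis using that[of t] t by (simp add: algebra_simps)
qed

text \<open>If \<open>b\<close> is small relative to \<open>a\<close>, this is the second order
  expansion, for negative \<open>a\<close> by symmetry; otherwise every term is dominated by
  \<open>\<bar>b\<bar> powr p\<close>. For \<open>p \<le> 2\<close> that power also absorbs the
  quadratic term, whence the case distinction in the statement.\<close>

lemma abs_powr_expansion:
  fixes p :: real
  assumes "p > 1"
  obtains C where "C \<ge> 0"
    "\<And>a b. \<bar>a + b\<bar> powr p \<le> \<bar>a\<bar> powr p + p * sgn a * \<bar>a\<bar> powr (p - 1) * b
       + C * ((if p > 2 then \<bar>a\<bar> powr (p - 2) * b\<^sup>2 else 0) + \<bar>b\<bar> powr p)"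
proof -
  \<comment> \<open>The first group serves \<open>\<bar>a\<bar> \<le> 2 * \<bar>b\<bar>\<close>:
    \<open>3 powr p\<close> for the left side and \<open>p * 2 powr (p - 1)\<close> for the linear
    term. The second group serves small \<open>b\<close>, with \<open>2 powr (p - 2)\<close> for
    \<open>p > 2\<close> and \<open>1\<close> for \<open>p \<le> 2\<close>.\<close>
  define C where "C = (3 powr p + p * 2 powr (p - 1)) + p * (p - 1) * (2 powr (p - 2) + 1)"
  have C1: "3 powr p + p * 2 powr (p - 1) \<le> C" "p * (p - 1) * 2 powr (p - 2) \<le> C" "p * (p - 1) \<le> C" "0 \<le> C"
    using mult_nonneg_nonneg[of p "p - 1"] assms unfolding C_def
    by (auto simp: distrib_left intro!: add_nonneg_nonneg add_increasing)
  have pos: "(a + b) powr p \<le> a powr p + p * a powr (p - 1) * b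
       + C * ((if p > 2 then a powr (p - 2) * b\<^sup>2 else 0) + \<bar>b\<bar> powr p)"
    if ab: "a > 0" "\<bar>b\<bar> < a / 2" for a b :: real
  proof -
    from powr_second_order[OF assms ab] obtain z where z: "a / 2 \<le> z" "z \<le> 2 * a"
      and le: "(a + b) powr p \<le> a powr p + p * a powr (p - 1) * b + p * (p - 1) * z powr (p - 2) * b\<^sup>2"
      by blast
    have "p * (p - 1) * z powr (p - 2) * b\<^sup>2 \<le> C * ((if p > 2 then a powr (p - 2) * b\<^sup>2 else 0) + \<bar>b\<bar> powr p)"
    proof (cases "p > 2")
      case True
      have "z powr (p - 2) \<le> (2 * a) powr (p - 2)" using z ab True by (intro powr_mono2) auto
      then have "p * (p - 1) * z powr (p - 2) * b\<^sup>2 \<le> p * (p - 1) * (2 * a) powr (p - 2) * b\<^sup>2"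
        using assms by (intro mult_right_mono mult_left_mono) auto
      also have "\<dots> = (p * (p - 1) * 2 powr (p - 2)) * (a powr (p - 2) * b\<^sup>2)"
        using ab by (simp add: powr_mult)
      also have "\<dots> \<le> C * (a powr (p - 2) * b\<^sup>2)" using C1 by (intro mult_right_mono) auto
      also have "\<dots> \<le> C * ((if p > 2 then a powr (p - 2) * b\<^sup>2 else 0) + \<bar>b\<bar> powr p)"
        using True C1 by (intro mult_left_mono) auto
      finally show ?thesis .
    next
      case False
      show ?thesis
      proof (cases "b = 0")
        case False
        note b = this
        \<comment> \<open>Here \<open>z \<ge> a / 2 > \<bar>b\<bar>\<close>, and the exponent is not
          positive.\<close>
        have "z powr (p - 2) \<le> \<bar>b\<bar> powr (p - 2)"
          using \<open>\<not> p > 2\<close> b z ab by (intro powr_mono2') auto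
        then have "p * (p - 1) * z powr (p - 2) * b\<^sup>2 \<le> p * (p - 1) * \<bar>b\<bar> powr (p - 2) * b\<^sup>2"
          using assms by (intro mult_right_mono mult_left_mono) auto
        also have "\<bar>b\<bar> powr (p - 2) * b\<^sup>2 = \<bar>b\<bar> powr p"
        proof -
          have "b\<^sup>2 = \<bar>b\<bar> powr 2" using b by simp
          then show ?thesis by (metis diff_add_cancel powr_add)
        qed
        then have "p * (p - 1) * \<bar>b\<bar> powr (p - 2) * b\<^sup>2 = p * (p - 1) * \<bar>b\<bar> powr p" by (simp add: mult.assoc)
        also have "\<dots> \<le> C * \<bar>b\<bar> powr p" using C1 by (intro mult_right_mono) auto
        finally show ?thesis using \<open>\<not> p > 2\<close> by simp
      qed (use C1 in auto)
    qed
    with le show ?thesis by linarith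
  qed
  show ?thesis
  proof (rule that[of C])
    show "C \<ge> 0" by (rule C1)
    fix a b :: real
    consider "a > 0" "\<bar>b\<bar> < a / 2" | "a < 0" "\<bar>b\<bar> < - a / 2" | "\<bar>a\<bar> \<le> 2 * \<bar>b\<bar>"
      by linarith
    then show "\<bar>a + b\<bar> powr p \<le> \<bar>a\<bar> powr p + p * sgn a * \<bar>a\<bar> powr (p - 1) * b
       + C * ((if p > 2 then \<bar>a\<bar> powr (p - 2) * b\<^sup>2 else 0) + \<bar>b\<bar> powr p)"
    proof cases
      case 1
      then show ?thesis using pos[of a b] by (auto simp: abs_if)
    next
      case 2
      then have "\<bar>a + b\<bar> = - a + - b" "\<bar>a\<bar> = - a" "sgn a = - 1" "- a > 0" "\<bar>- b\<bar> < - a / 2"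
        by auto
      then show ?thesis using pos[of "- a" "- b"] by (cases "p > 2") auto
    next
      case 3
      have "\<bar>a + b\<bar> powr p \<le> (3 * \<bar>b\<bar>) powr p" using 3 assms by (intro powr_mono2) auto
      then have 1: "\<bar>a + b\<bar> powr p \<le> 3 powr p * \<bar>b\<bar> powr p" by (simp add: powr_mult)
      have "\<bar>a\<bar> powr (p - 1) * \<bar>b\<bar> \<le> (2 * \<bar>b\<bar>) powr (p - 1) * \<bar>b\<bar>"
        using 3 assms by (intro mult_right_mono powr_mono2) auto
      also have "\<dots> = 2 powr (p - 1) * \<bar>b\<bar> powr p"
      proof -
        have "\<bar>b\<bar> powr (p - 1) * \<bar>b\<bar> = \<bar>b\<bar> powr p" by (metis abs_ge_zero diff_add_cancel powr_add powr_one)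
        then show ?thesis by (simp add: powr_mult)
      qed
      finally have "\<bar>a\<bar> powr (p - 1) * \<bar>b\<bar> \<le> 2 powr (p - 1) * \<bar>b\<bar> powr p" .
      moreover have "- (p * sgn a * \<bar>a\<bar> powr (p - 1) * b) \<le> p * (\<bar>a\<bar> powr (p - 1) * \<bar>b\<bar>)"
      proof -
        have "- (p * sgn a * \<bar>a\<bar> powr (p - 1) * b) \<le> \<bar>p * sgn a * \<bar>a\<bar> powr (p - 1) * b\<bar>" by linarith
        also have "\<dots> \<le> p * (\<bar>a\<bar> powr (p - 1) * \<bar>b\<bar>)"
          using assms by (simp add: abs_mult sgn_real_def)
        finally show ?thesis .
      qed
      ultimately have 2: "- (p * sgn a * \<bar>a\<bar> powr (p - 1) * b) \<le> p * (2 powr (p - 1) * \<bar>b\<bar> powr p)"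
        using assms by (smt (verit, best) mult_left_mono)
      have "(3 powr p + p * 2 powr (p - 1)) * \<bar>b\<bar> powr p \<le> C * \<bar>b\<bar> powr p"
        using C1 by (intro mult_right_mono) auto
      also have "\<dots> \<le> C * ((if p > 2 then \<bar>a\<bar> powr (p - 2) * b\<^sup>2 else 0) + \<bar>b\<bar> powr p)"
        using C1 by (intro mult_left_mono) auto
      finally have "3 powr p * \<bar>b\<bar> powr p + p * (2 powr (p - 1) * \<bar>b\<bar> powr p)
          \<le> C * ((if p > 2 then \<bar>a\<bar> powr (p - 2) * b\<^sup>2 else 0) + \<bar>b\<bar> powr p)"
        by (simp add: distrib_right)
      then show ?thesis using 1 2 powr_ge_zero[of "\<bar>a\<bar>" p] by linarith
    qed
  qed
qed

text \<open>Young's inequality with the conjugate exponents \<open>p / (p - 2)\<close> and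
  \<open>p / 2\<close>. Comparing \<open>s\<close> with \<open>\<delta> * a\<^sup>2\<close> decides
  which term on the right dominates alone. In the application \<open>s\<close> bounds a variance and
  \<open>\<delta>\<close> is of order \<open>1/k\<close>.\<close>

lemma powr_young:
  fixes p \<delta> :: real
  assumes "p > 2" "\<delta> > 0" "s \<ge> 0" "a \<ge> 0"
  shows "a powr (p - 2) * s \<le> \<delta> * a powr p + \<delta> powr (- ((p - 2) / 2)) * s powr (p / 2)"
proof (cases "s \<le> \<delta> * a\<^sup>2")
  case True
  have "a powr (p - 2) * s \<le> a powr (p - 2) * (\<delta> * a\<^sup>2)" using True by (intro mult_left_mono) auto
  also have "\<dots> = \<delta> * a powr p"
  proof (cases "a = 0")
    case False
    then have "a\<^sup>2 = a powr 2" using assms by simp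
    then show ?thesis by (metis diff_add_cancel mult.left_commute powr_add)
  qed (use assms in auto)
  finally show ?thesis by (simp add: add_increasing2)
next
  case False
  then have s: "s > 0" using assms by (smt (verit) mult_nonneg_nonneg zero_le_power2)
  have "a\<^sup>2 \<le> s / \<delta>" using False assms by (simp add: field_simps)
  then have "a \<le> (s / \<delta>) powr (1 / 2)" using assms s by (simp add: powr_half_sqrt real_le_rsqrt)
  then have "a powr (p - 2) \<le> ((s / \<delta>) powr (1 / 2)) powr (p - 2)" using assms by (intro powr_mono2) auto
  also have "\<dots> = (s / \<delta>) powr ((p - 2) / 2)" by (simp add: powr_powr)
  also have "\<dots> = s powr ((p - 2) / 2) * \<delta> powr (- ((p - 2) / 2))"
    using assms s by (simp add: powr_divide powr_minus divide_simps)
  finally have "a powr (p - 2) * s \<le> s powr ((p - 2) / 2) * \<delta> powr (- ((p - 2) / 2)) * s"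
    using s by (intro mult_right_mono) auto
  also have "\<dots> = \<delta> powr (- ((p - 2) / 2)) * s powr (p / 2)"
  proof -
    have "s powr ((p - 2) / 2) * s = s powr ((p - 2) / 2 + 1)" using s by (simp add: powr_add)
    also have "(p - 2) / 2 + 1 = p / 2" by (simp add: field_simps)
    finally show ?thesis by (simp add: mult.assoc mult.left_commute)
  qed
  finally show ?thesis using assms by (simp add: add_increasing)
qed

text \<open>With \<open>k\<close> so large that \<open>C0 * k * (1 / k) powr \<tau>\<close> is below
  one half, strong induction closes: half of the bound pays for the shorter block and half for the
  error. \<open>A\<close> is quantified before \<open>b\<close>, so that one constant serves all
  observables.\<close>

lemma division_recursion_bound:
  fixes \<tau> C0 c e :: real and E :: "nat \<Rightarrow> real"
  assumes "\<tau> > 1" "C0 \<ge> 0" "c \<ge> 0" "e \<ge> 0"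
  shows "\<exists>A>0. \<forall>b. (\<forall>k\<ge>1. \<forall>n\<ge>2 * k.
       b n \<le> C0 * real k * b (n div (2 * k)) + E k * real n powr \<tau>) \<longrightarrow>
     (\<forall>n\<ge>1. b n \<le> c * real n powr e) \<longrightarrow> (\<forall>n\<ge>1. b n \<le> A * real n powr \<tau>)"
proof -
  have "((\<lambda>k. real k powr (1 - \<tau>)) \<longlongrightarrow> 0) sequentially"
    using assms by (intro tendsto_neg_powr filterlim_real_sequentially) auto
  then have "((\<lambda>k. C0 * real k powr (1 - \<tau>)) \<longlongrightarrow> C0 * 0) sequentially"
    by (intro tendsto_mult tendsto_const)
  then have "\<forall>\<^sub>F k in sequentially. C0 * real k powr (1 - \<tau>) < 1 / 2"
    by (intro order_tendstoD) auto
  then have "\<forall>\<^sub>F k in sequentially. C0 * real k powr (1 - \<tau>) < 1 / 2 \<and> k \<ge> 1"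
    using eventually_ge_at_top[of 1] by eventually_elim auto
  then obtain k where k: "C0 * real k powr (1 - \<tau>) < 1 / 2" "k \<ge> 1"
    using eventually_happens[of _ sequentially] by auto
  \<comment> \<open>The summands make \<open>A\<close> positive, keep \<open>E k\<close> below
    \<open>A / 2\<close>, and cover the starting values \<open>n < 2 * k\<close>.\<close>
  define A where "A = 1 + 2 * \<bar>E k\<bar> + c * real (2 * k) powr e"
  have "0 \<le> c * real (2 * k) powr e" using assms by simp
  then have A: "A > 0" "2 * E k \<le> A" "c * real (2 * k) powr e \<le> A"
    unfolding A_def by linarith+
  show ?thesis
  proof (rule exI[of _ A], rule conjI[OF A(1)], intro allI impI)
    fix b :: "nat \<Rightarrow> real" and n :: nat
    assume rec: "\<forall>k\<ge>1. \<forall>n\<ge>2 * k. b n \<le> C0 * real k * b (n div (2 * k)) + E k * real n powr \<tau>"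
      and triv: "\<forall>n\<ge>1. b n \<le> c * real n powr e" and "n \<ge> 1"
    from \<open>n \<ge> 1\<close> show "b n \<le> A * real n powr \<tau>"
    proof (induction n rule: less_induct)
      case (less n)
      show ?case
      proof (cases "n \<ge> 2 * k")
        case True
        define m where "m = n div (2 * k)"
        have m: "m \<ge> 1" "m < n" "real m \<le> real n / real k"
        proof -
          show "m \<ge> 1" using True k unfolding m_def by (metis One_nat_def Suc_leI div_greater_zero_iff mult_pos_pos pos2 zero_less_one_class.zero_less_one order_less_le_trans)
          show "m < n" using less.prems k by (simp add: m_def)
          have "m * k \<le> m * (2 * k)" by simp
          also have "\<dots> \<le> n" unfolding m_def by (rule div_times_less_eq_dividend)
          finally show "real m \<le> real n / real k" using k
            by (simp add: field_simps flip: of_nat_mult)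
        qed
        have "b m \<le> A * real m powr \<tau>" using less.IH m by blast
        also have "\<dots> \<le> A * (real n / real k) powr \<tau>"
          using m A assms by (intro mult_left_mono powr_mono2) auto
        finally have "C0 * real k * b m \<le> C0 * real k * (A * (real n / real k) powr \<tau>)"
          using assms by (intro mult_left_mono) auto
        also have "\<dots> = (C0 * real k powr (1 - \<tau>)) * (A * real n powr \<tau>)"
          using k by (simp add: powr_divide powr_diff)
        also have "\<dots> \<le> 1 / 2 * (A * real n powr \<tau>)"
          using k A by (intro mult_right_mono) auto
        finally have "b n \<le> 1 / 2 * (A * real n powr \<tau>) + E k * real n powr \<tau>"
          using rec[rule_format, OF k(2) True] by (simp add: m_def)
        also have "\<dots> = (A / 2 + E k) * real n powr \<tau>" by (simp add: algebra_simps)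
        also have "\<dots> \<le> A * real n powr \<tau>" using A by (intro mult_right_mono) auto
        finally show ?thesis .
      next
        case False
        have "b n \<le> c * real n powr e" using triv less.prems by blast
        also have "\<dots> \<le> c * real (2 * k) powr e"
          using False assms by (intro mult_left_mono powr_mono2) auto
        also have "\<dots> \<le> A * 1" using A by simp
        also have "\<dots> \<le> A * real n powr \<tau>"
          using less.prems assms A by (intro mult_left_mono ge_one_powr_ge_zero) auto
        finally show ?thesis .
      qed
    qed
  qed
qed

section \<open>Decorrelated maps\<close>

text \<open>Integration of \<open>abs_powr_expansion\<close> with \<open>a\<close> fixed; the linear
  term disappears because \<open>Z\<close> is centred. \<open>K\<close> is chosen before
  \<open>\<delta>\<close>, and only the coefficient \<open>D\<close> of the variance term
  deteriorates as \<open>\<delta>\<close> shrinks. This is what keeps the factor of the main term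
  independent of \<open>k\<close>.\<close>

lemma (in prob_space) moment_shift_le:
  fixes p :: real
  assumes "p > 1"
  obtains K where "K \<ge> 1"
    "\<And>\<delta>. \<delta> > 0 \<Longrightarrow> \<exists>D\<ge>0. \<forall>Z B s a. Z \<in> borel_measurable M \<longrightarrow> (\<forall>x. \<bar>Z x\<bar> \<le> B) \<longrightarrow> expectation Z = 0 \<longrightarrow>
       s \<ge> 0 \<longrightarrow> (p > 2 \<longrightarrow> expectation (\<lambda>x. (Z x)\<^sup>2) \<le> s) \<longrightarrow>
       expectation (\<lambda>x. \<bar>a + Z x\<bar> powr p)
         \<le> (1 + \<delta>) * \<bar>a\<bar> powr p + K * expectation (\<lambda>x. \<bar>Z x\<bar> powr p) + D * s powr (p / 2)"
proof -
  from abs_powr_expansion[OF assms] obtain C where C: "C \<ge> 0"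
    and exp: "\<And>a b. \<bar>a + b\<bar> powr p \<le> \<bar>a\<bar> powr p + p * sgn a * \<bar>a\<bar> powr (p - 1) * b
       + C * ((if p > 2 then \<bar>a\<bar> powr (p - 2) * b\<^sup>2 else 0) + \<bar>b\<bar> powr p)"
    by blast
  show ?thesis
  proof (rule that[of "C + 1"])
    fix \<delta> :: real assume \<delta>: "\<delta> > 0"
    \<comment> \<open>The denominator \<open>C + 1\<close> is positive even for \<open>C = 0\<close>
      and still gives \<open>C * \<epsilon> \<le> \<delta>\<close>.\<close>
    define \<epsilon> where "\<epsilon> = \<delta> / (C + 1)"
    have \<epsilon>: "\<epsilon> > 0" "C * \<epsilon> \<le> \<delta>" using \<delta> C by (auto simp: \<epsilon>_def field_simps)
    define D where "D = C * \<epsilon> powr (- ((p - 2) / 2))"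
    show "\<exists>D\<ge>0. \<forall>Z B s a. Z \<in> borel_measurable M \<longrightarrow> (\<forall>x. \<bar>Z x\<bar> \<le> B) \<longrightarrow> expectation Z = 0 \<longrightarrow>
       s \<ge> 0 \<longrightarrow> (p > 2 \<longrightarrow> expectation (\<lambda>x. (Z x)\<^sup>2) \<le> s) \<longrightarrow>
       expectation (\<lambda>x. \<bar>a + Z x\<bar> powr p)
         \<le> (1 + \<delta>) * \<bar>a\<bar> powr p + (C + 1) * expectation (\<lambda>x. \<bar>Z x\<bar> powr p) + D * s powr (p / 2)"
    proof (intro exI[of _ D] conjI allI impI)
      show "D \<ge> 0" using C by (simp add: D_def)
      fix Z :: "'a \<Rightarrow> real" and B s a :: real
      assume Z[measurable]: "Z \<in> borel_measurable M" and B: "\<forall>x. \<bar>Z x\<bar> \<le> B"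
        and Z0: "expectation Z = 0" and s: "s \<ge> 0" and Z2: "p > 2 \<longrightarrow> expectation (\<lambda>x. (Z x)\<^sup>2) \<le> s"
      have intZ: "integrable M Z"
        using B by (intro integrable_const_bound[of _ B]) auto
      have "(Z x)\<^sup>2 \<le> B\<^sup>2" for x using power_mono[OF B[rule_format, of x], of 2] by simp
      then have intZ2: "integrable M (\<lambda>x. (Z x)\<^sup>2)"
        by (intro integrable_const_bound[of _ "B\<^sup>2"]) auto
      have bnd: "\<bar>a + Z x\<bar> powr p \<le> (\<bar>a\<bar> + B) powr p" for a x
        using B[rule_format, of x] assms by (intro powr_mono2) auto
      have intp: "integrable M (\<lambda>x. \<bar>a + Z x\<bar> powr p)" for a
        using bnd[of a] by (intro integrable_const_bound[of _ "(\<bar>a\<bar> + B) powr p"]) auto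
      have intp0: "integrable M (\<lambda>x. \<bar>Z x\<bar> powr p)" using intp[of 0] by simp
      have intg: "integrable M (\<lambda>x. if p > 2 then \<bar>a\<bar> powr (p - 2) * (Z x)\<^sup>2 else 0)"
        using intZ2 by (cases "p > 2") auto
      have "expectation (\<lambda>x. \<bar>a + Z x\<bar> powr p)
          \<le> expectation (\<lambda>x. \<bar>a\<bar> powr p + p * sgn a * \<bar>a\<bar> powr (p - 1) * Z x
             + C * ((if p > 2 then \<bar>a\<bar> powr (p - 2) * (Z x)\<^sup>2 else 0) + \<bar>Z x\<bar> powr p))"
        using intZ intg intp0 by (intro integral_mono exp intp) auto
      also have "\<dots> = \<bar>a\<bar> powr p
             + C * ((if p > 2 then \<bar>a\<bar> powr (p - 2) * expectation (\<lambda>x. (Z x)\<^sup>2) else 0) + expectation (\<lambda>x. \<bar>Z x\<bar> powr p))"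
        using intZ intg intp0 Z0 intZ2 by (cases "p > 2") (auto simp: prob_space)
      also have "\<dots> \<le> (1 + \<delta>) * \<bar>a\<bar> powr p + (C + 1) * expectation (\<lambda>x. \<bar>Z x\<bar> powr p) + D * s powr (p / 2)"
      proof -
        have "C * (if p > 2 then \<bar>a\<bar> powr (p - 2) * expectation (\<lambda>x. (Z x)\<^sup>2) else 0)
            \<le> \<delta> * \<bar>a\<bar> powr p + D * s powr (p / 2)"
        proof (cases "p > 2")
          case True
          have "C * (\<bar>a\<bar> powr (p - 2) * expectation (\<lambda>x. (Z x)\<^sup>2)) \<le> C * (\<bar>a\<bar> powr (p - 2) * s)"
            using Z2 True C by (intro mult_left_mono) auto
          also have "\<dots> \<le> C * (\<epsilon> * \<bar>a\<bar> powr p + \<epsilon> powr (- ((p - 2) / 2)) * s powr (p / 2))"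
            using powr_young[OF True \<epsilon>(1) s, of "\<bar>a\<bar>"] C by (intro mult_left_mono) auto
          also have "\<dots> = (C * \<epsilon>) * \<bar>a\<bar> powr p + D * s powr (p / 2)"
            by (simp add: D_def algebra_simps)
          also have "\<dots> \<le> \<delta> * \<bar>a\<bar> powr p + D * s powr (p / 2)"
            using \<epsilon> by (intro add_right_mono mult_right_mono) auto
          finally show ?thesis using True by simp
        qed (use \<delta> \<open>D \<ge> 0\<close> in auto)
        moreover have "0 \<le> expectation (\<lambda>x. \<bar>Z x\<bar> powr p)" by simp
        ultimately show ?thesis unfolding distrib_left distrib_right by linarith
      qed
      finally show "expectation (\<lambda>x. \<bar>a + Z x\<bar> powr p)
         \<le> (1 + \<delta>) * \<bar>a\<bar> powr p + (C + 1) * expectation (\<lambda>x. \<bar>Z x\<bar> powr p) + D * s powr (p / 2)" .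
    qed
  qed (use C in auto)
qed

text \<open>A triple \<open>(z, z', r) \<in> R\<close> prescribes that a Hoelder observable with constant \<open>L\<close> varies by at
  most \<open>L * r\<close> between \<open>z\<close> and \<open>z'\<close>.\<close>

locale decorrelated_map = prob_space \<mu> for \<mu> :: "'m measure" +
  fixes T :: "'m \<Rightarrow> 'm" and R :: "('m \<times> 'm \<times> real) set" and \<gamma> C :: real
  assumes space_UNIV: "space \<mu> = UNIV"
    and T_measurable [measurable]: "T \<in> \<mu> \<rightarrow>\<^sub>M \<mu>"
    and T_invariant: "distr \<mu> \<mu> T = \<mu>"
    and C_pos: "C > 0" and rate: "\<gamma> > 1"
    and decorrelate: "\<And>p q (n :: nat \<Rightarrow> nat) G B L. 1 \<le> p \<Longrightarrow> p < q \<Longrightarrow> mono_on {..<q} n \<Longrightarrow> n (p - 1) < n p \<Longrightarrow>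
      G \<in> borel_measurable (\<Pi>\<^sub>M j\<in>{..<q}. \<mu>) \<Longrightarrow> (\<And>x. \<bar>G x\<bar> \<le> B) \<Longrightarrow> L \<ge> 0 \<Longrightarrow>
      (\<And>i x z z' r. i < q \<Longrightarrow> (z, z', r) \<in> R \<Longrightarrow> \<bar>G (x(i := z)) - G (x(i := z'))\<bar> \<le> L * r) \<Longrightarrow>
      \<bar>(\<integral>x. G (\<lambda>i\<in>{..<q}. (T ^^ n i) x) \<partial>\<mu>)
         - (\<integral>(x\<^sub>0, x\<^sub>1). G (\<lambda>i\<in>{..<q}. (T ^^ n i) (if i < p then x\<^sub>0 else x\<^sub>1)) \<partial>(\<mu> \<Otimes>\<^sub>M \<mu>))\<bar>
        \<le> C * real (n p - n (p - 1)) powr (- \<gamma>) * (B + real q * L)"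
begin

lemma funpow_measurable [measurable]: "T ^^ k \<in> \<mu> \<rightarrow>\<^sub>M \<mu>"
  by (induction k) auto

lemma expectation_funpow:
  fixes f :: "'m \<Rightarrow> real"
  assumes [measurable]: "f \<in> borel_measurable \<mu>"
  shows "expectation (\<lambda>x. f ((T ^^ k) x)) = expectation f"
proof (induction k)
  case (Suc k)
  have "expectation (\<lambda>x. f ((T ^^ Suc k) x)) = expectation (\<lambda>x. f ((T ^^ k) (T x)))"
    by (simp only: funpow_Suc_right o_apply)
  also have "\<dots> = integral\<^sup>L (distr \<mu> \<mu> T) (\<lambda>x. f ((T ^^ k) x))"
    by (rule integral_distr[symmetric]) measurable
  also have "\<dots> = expectation f" by (simp add: T_invariant Suc.IH)
  finally show ?case .
qed simp

lemma integrable_bounded: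
  fixes f :: "'m \<Rightarrow> real"
  assumes "f \<in> borel_measurable \<mu>" "\<And>x. \<bar>f x\<bar> \<le> B"
  shows "integrable \<mu> f"
  using assms by (intro integrable_const_bound[of _ B]) auto

section \<open>Observables of orbit segments and their concatenation\<close>

definition orbit :: "nat \<Rightarrow> 'm \<Rightarrow> nat \<Rightarrow> 'm" where
  "orbit N x = (\<lambda>i\<in>{..<N}. (T ^^ i) x)"

text \<open>The bounds range over all functions \<open>x\<close> and all indices \<open>i\<close>,
  not only over extensional points and \<open>i < N\<close>, so that windows of longer points can be
  inserted without side conditions.\<close>

definition sep_obs :: "nat \<Rightarrow> real \<Rightarrow> real \<Rightarrow> ((nat \<Rightarrow> 'm) \<Rightarrow> real) \<Rightarrow> bool" where
  "sep_obs N B L f \<longleftrightarrow> f \<in> borel_measurable (\<Pi>\<^sub>M j\<in>{..<N}. \<mu>) \<and> L \<ge> 0 \<and> (\<forall>x. \<bar>f x\<bar> \<le> B) \<and>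
     (\<forall>i x. \<forall>(z, z', r)\<in>R. \<bar>f (x(i := z)) - f (x(i := z'))\<bar> \<le> L * r)"

lemma sep_obsD:
  assumes "sep_obs N B L f"
  shows "f \<in> borel_measurable (\<Pi>\<^sub>M j\<in>{..<N}. \<mu>)" "L \<ge> 0" "\<bar>f x\<bar> \<le> B"
    "(z, z', r) \<in> R \<Longrightarrow> \<bar>f (x(i := z)) - f (x(i := z'))\<bar> \<le> L * r"
  using assms unfolding sep_obs_def by (blast, blast, blast, fast)

lemma orbit_measurable [measurable]: "orbit N \<in> \<mu> \<rightarrow>\<^sub>M (\<Pi>\<^sub>M j\<in>{..<N}. \<mu>)"
  unfolding orbit_def by measurable

lemma window_measurable:
  fixes a :: nat
  assumes "a + m \<le> q"
  shows "(\<lambda>x. \<lambda>i\<in>{..<m}. x (a + i)) \<in> (\<Pi>\<^sub>M j\<in>{..<q}. \<mu>) \<rightarrow>\<^sub>M (\<Pi>\<^sub>M j\<in>{..<m}. \<mu>)"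
  using assms by (intro measurable_restrict measurable_component_singleton) auto

lemma window_upd:
  fixes a j :: nat
  shows "(\<lambda>i\<in>{..<m}. (x(j := z)) (a + i)) =
     (if a \<le> j \<and> j < a + m then (\<lambda>i\<in>{..<m}. x (a + i))(j - a := z) else (\<lambda>i\<in>{..<m}. x (a + i)))"
  by (auto simp: fun_eq_iff)

text \<open>The \<open>g\<close> coordinates between the two windows are skipped but counted, so
  that on an orbit the second window starts at time \<open>N + g\<close>. The offset
  \<open>0\<close> gives both windows the shape of \<open>window_upd\<close>.\<close>

definition append_obs where
  "append_obs N g m f h x = f (\<lambda>i\<in>{..<N}. x (0 + i)) + h (\<lambda>i\<in>{..<m}. x (N + g + i))"

text \<open>The windows are disjoint, so a single coordinate affects at most one of \<open>f\<close>
  and \<open>h\<close>: sup bounds add up, but \<open>L\<close> stays the same however many blocks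
  are joined.\<close>

lemma sep_obs_append:
  assumes f: "sep_obs N B L f" and h: "sep_obs m B' L h"
  shows "sep_obs (N + g + m) (B + B') L (append_obs N g m f h)"
  unfolding sep_obs_def
proof (intro conjI allI ballI, goal_cases)
  case 1
  show ?case unfolding append_obs_def
    by (intro borel_measurable_add measurable_compose[OF window_measurable sep_obsD(1)[OF f]]
        measurable_compose[OF window_measurable sep_obsD(1)[OF h]]) auto
next
  case 2
  show ?case using sep_obsD(2)[OF f] .
next
  case (3 x)
  show ?case using sep_obsD(3)[OF f, of "\<lambda>i\<in>{..<N}. x (0 + i)"]
      sep_obsD(3)[OF h, of "\<lambda>i\<in>{..<m}. x (N + g + i)"]
    unfolding append_obs_def by linarith
next
  case (4 i x t)
  obtain z z' r where t: "t = (z, z', r)" "(z, z', r) \<in> R" using 4 by (cases t) auto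
  \<comment> \<open>For a coordinate in the gap the difference is zero, and the claim becomes
    \<open>0 \<le> L * r\<close>. This sign follows from the oscillation bound itself.\<close>
  have "0 \<le> \<bar>f (x(i := z)) - f (x(i := z'))\<bar>" by simp
  also have "\<dots> \<le> L * r" using sep_obsD(4)[OF f t(2)] .
  finally have "0 \<le> L * r" .
  then show ?case
    using sep_obsD(4)[OF f t(2), of "\<lambda>i\<in>{..<N}. x (0 + i)" i]
      sep_obsD(4)[OF h t(2), of "\<lambda>i\<in>{..<m}. x (N + g + i)" "i - (N + g)"]
    unfolding append_obs_def t(1) window_upd by auto
qed

lemma append_obs_orbit:
  "append_obs N g m f h (orbit (N + g + m) x) = f (orbit N x) + h (orbit m ((T ^^ (N + g)) x))"
proof -
  have "(\<lambda>i\<in>{..<N}. orbit (N + g + m) x (0 + i)) = orbit N x"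
    by (auto simp: orbit_def fun_eq_iff restrict_def)
  moreover have "(\<lambda>i\<in>{..<m}. orbit (N + g + m) x (N + g + i)) = orbit m ((T ^^ (N + g)) x)"
  proof
    fix i
    have "(T ^^ (N + g + i)) x = (T ^^ i) ((T ^^ (N + g)) x)"
      by (metis add.commute comp_apply funpow_add)
    then show "(\<lambda>i\<in>{..<m}. orbit (N + g + m) x (N + g + i)) i = orbit m ((T ^^ (N + g)) x) i"
      by (simp add: orbit_def)
  qed
  ultimately show ?thesis by (simp only: append_obs_def)
qed

lemma sep_obs_nonneg: "sep_obs N B L f \<Longrightarrow> B \<ge> 0"
  using sep_obsD(3)[of N B L f undefined] by linarith

text \<open>The correlation bound for the \<open>p\<close>-th power of a sum of past and future. On
  the right the past value is a constant for the inner expectation, which is the setting of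
  \<open>moment_shift_le\<close>.\<close>

lemma decorrelate_moment:
  assumes p: "p > 1" and f: "sep_obs N B L f" and h: "sep_obs m B' L h"
    and N: "N \<ge> 1" and m: "m \<ge> 1" and g: "g \<ge> 1"
  shows "expectation (\<lambda>x. \<bar>f (orbit N x) + h (orbit m ((T ^^ (N + g)) x))\<bar> powr p)
     \<le> expectation (\<lambda>x. expectation (\<lambda>y. \<bar>f (orbit N x) + h (orbit m y)\<bar> powr p))
       + C * real g powr (- \<gamma>) * ((B + B') powr p + real (N + m) * (p * (B + B') powr (p - 1) * L))"
proof -
  define G where "G = (\<lambda>x. \<bar>append_obs N 0 m f h x\<bar> powr p)"
  \<comment> \<open>The gap is put into the times rather than into the coordinates, hence the gap
    \<open>0\<close> in \<open>G\<close>. The jump at index \<open>N\<close> has length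
    \<open>g + 1\<close>, which is estimated by \<open>g\<close> at the end.\<close>
  define n where "n = (\<lambda>i. if i < N then i else i + g)"
  note fh = sep_obs_append[OF f h, of 0, simplified]
  note [measurable] = sep_obsD(1)[OF f] sep_obsD(1)[OF h] sep_obsD(1)[OF fh]
  have G_orb: "G (\<lambda>i\<in>{..<N + m}. (T ^^ n i) (if i < N then x else y))
      = \<bar>f (orbit N x) + h (orbit m ((T ^^ (N + g)) y))\<bar> powr p" for x y
  proof -
    let ?X = "\<lambda>i\<in>{..<N + m}. (T ^^ n i) (if i < N then x else y)"
    have "(\<lambda>i\<in>{..<N}. ?X (0 + i)) = orbit N x"
      by (auto simp: orbit_def fun_eq_iff restrict_def n_def)
    moreover have "(\<lambda>i\<in>{..<m}. ?X (N + 0 + i)) = orbit m ((T ^^ (N + g)) y)"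
    proof
      fix i
      have "(T ^^ (N + i + g)) y = (T ^^ i) ((T ^^ (N + g)) y)"
        by (metis add.assoc add.commute comp_apply funpow_add)
      then show "(\<lambda>i\<in>{..<m}. ?X (N + 0 + i)) i = orbit m ((T ^^ (N + g)) y) i"
        by (simp add: orbit_def n_def)
    qed
    ultimately show ?thesis by (simp only: G_def append_obs_def)
  qed
  have bnd: "\<bar>f (orbit N x) + h (orbit m y)\<bar> \<le> B + B'" for x y
    using sep_obsD(3)[OF f, of "orbit N x"] sep_obsD(3)[OF h, of "orbit m y"] by linarith
  have B0: "0 \<le> B + B'" using sep_obs_nonneg[OF f] sep_obs_nonneg[OF h] by simp
  have "\<bar>(\<integral>x. G (\<lambda>i\<in>{..<N + m}. (T ^^ n i) x) \<partial>\<mu>)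
         - (\<integral>(x\<^sub>0, x\<^sub>1). G (\<lambda>i\<in>{..<N + m}. (T ^^ n i) (if i < N then x\<^sub>0 else x\<^sub>1)) \<partial>(\<mu> \<Otimes>\<^sub>M \<mu>))\<bar>
        \<le> C * real (n N - n (N - 1)) powr (- \<gamma>)
          * ((B + B') powr p + real (N + m) * (p * (B + B') powr (p - 1) * L))"
  proof (rule decorrelate)
    show "mono_on {..<N + m} n" by (auto simp: mono_on_def n_def)
    show "G \<in> borel_measurable (\<Pi>\<^sub>M j\<in>{..<N + m}. \<mu>)" unfolding G_def by measurable
    show "\<bar>G x\<bar> \<le> (B + B') powr p" for x
      using sep_obsD(3)[OF fh, of x] p B0 by (auto simp: G_def intro!: powr_mono2)
    show "0 \<le> p * (B + B') powr (p - 1) * L" using p sep_obsD(2)[OF f] by simp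
    fix i x z z' r assume "i < N + m" "(z, z', r) \<in> R"
    have "\<bar>G (x(i := z)) - G (x(i := z'))\<bar> \<le> p * (B + B') powr (p - 1) *
        \<bar>append_obs N 0 m f h (x(i := z)) - append_obs N 0 m f h (x(i := z'))\<bar>"
      unfolding G_def using p by (intro abs_powr_lipschitz sep_obsD(3)[OF fh]) auto
    also have "\<dots> \<le> p * (B + B') powr (p - 1) * (L * r)"
      using p by (intro mult_left_mono sep_obsD(4)[OF fh] \<open>(z, z', r) \<in> R\<close>) auto
    finally show "\<bar>G (x(i := z)) - G (x(i := z'))\<bar> \<le> p * (B + B') powr (p - 1) * L * r"
      by (simp add: mult.assoc)
  qed (use N m g in \<open>auto simp: n_def\<close>)
  also have "(\<lambda>x. G (\<lambda>i\<in>{..<N + m}. (T ^^ n i) x))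
      = (\<lambda>x. \<bar>f (orbit N x) + h (orbit m ((T ^^ (N + g)) x))\<bar> powr p)"
    using G_orb[of x x for x] by simp
  also have "(\<integral>(x\<^sub>0, x\<^sub>1). G (\<lambda>i\<in>{..<N + m}. (T ^^ n i) (if i < N then x\<^sub>0 else x\<^sub>1)) \<partial>(\<mu> \<Otimes>\<^sub>M \<mu>))
      = expectation (\<lambda>x. expectation (\<lambda>y. \<bar>f (orbit N x) + h (orbit m y)\<bar> powr p))"
  proof -
    interpret P: pair_prob_space \<mu> \<mu> ..
    have "integrable (\<mu> \<Otimes>\<^sub>M \<mu>) (\<lambda>(x, y). \<bar>f (orbit N x) + h (orbit m ((T ^^ (N + g)) y))\<bar> powr p)"
      using bnd p by (intro P.P.integrable_const_bound[of _ "(B + B') powr p"])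
        (auto simp: split_beta intro!: AE_I2 powr_mono2)
    from P.integral_fst'[OF this] have "(\<integral>(x, y). \<bar>f (orbit N x) + h (orbit m ((T ^^ (N + g)) y))\<bar> powr p \<partial>(\<mu> \<Otimes>\<^sub>M \<mu>))
      = expectation (\<lambda>x. expectation (\<lambda>y. \<bar>f (orbit N x) + h (orbit m ((T ^^ (N + g)) y))\<bar> powr p))"
      by simp
    \<comment> \<open>After decoupling, invariance removes the time shift of the second
      block.\<close>
    also have "\<dots> = expectation (\<lambda>x. expectation (\<lambda>y. \<bar>f (orbit N x) + h (orbit m y)\<bar> powr p))"
      by (intro Bochner_Integration.integral_cong refl expectation_funpow) measurable
    finally show ?thesis by (simp only: G_orb)
  qed
  also have "C * real (n N - n (N - 1)) powr (- \<gamma>)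
          * ((B + B') powr p + real (N + m) * (p * (B + B') powr (p - 1) * L))
      \<le> C * real g powr (- \<gamma>) * ((B + B') powr p + real (N + m) * (p * (B + B') powr (p - 1) * L))"
    using C_pos rate p N g sep_obsD(2)[OF f]
    by (intro mult_right_mono mult_left_mono powr_mono2') (auto simp: n_def)
  finally show ?thesis by linarith
qed

end

section \<open>Sums over separated blocks\<close>

lemma sum_even_odd:
  fixes f :: "nat \<Rightarrow> 'a :: comm_monoid_add"
  shows "(\<Sum>i<2 * k. f i) = (\<Sum>l<k. f (2 * l)) + (\<Sum>l<k. f (2 * l + 1))"
  by (induction k) (simp_all add: ac_simps)

text \<open>The geometric weights accumulated in \<open>k\<close> steps are at most
  \<open>(1 + 1/k) ^ k \<le> exp 1 \<le> 3\<close>, so the result is linear in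
  \<open>k\<close>.\<close>

lemma affine_recursion_bound:
  fixes A :: "nat \<Rightarrow> real"
  assumes "A 0 \<le> W" "W \<ge> 0" "k \<ge> 1" "\<And>j. Suc j < k \<Longrightarrow> A (Suc j) \<le> (1 + 1 / real k) * A j + W"
  shows "A (k - 1) \<le> 3 * real k * W"
proof -
  define q where "q = 1 + 1 / real k"
  have q: "q \<ge> 1" by (simp add: q_def)
  \<comment> \<open>The sum of the first \<open>j + 1\<close> powers of \<open>q\<close> is
    estimated by \<open>j + 1\<close> times the largest.\<close>
  have ind: "A j \<le> (real j + 1) * q ^ j * W" if "j < k" for j
    using that
  proof (induction j)
    case (Suc j)
    have "A (Suc j) \<le> q * A j + W" using assms(4) Suc.prems by (simp add: q_def)
    moreover have "q * A j \<le> q * ((real j + 1) * q ^ j * W)" using Suc q by (intro mult_left_mono) auto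
    moreover have "W \<le> q ^ Suc j * W"
      using mult_right_mono[OF one_le_power[OF q], of W "Suc j"] assms by simp
    ultimately have "A (Suc j) \<le> q * ((real j + 1) * q ^ j * W) + q ^ Suc j * W" by linarith
    then show ?case by (simp add: algebra_simps)
  qed (use assms in simp)
  have "q ^ (k - 1) \<le> q ^ k" using q by (intro power_increasing) auto
  also have "\<dots> \<le> exp 1"
    using exp_ge_one_plus_x_over_n_power_n[of k 1] assms(3) by (simp add: q_def)
  also have "\<dots> \<le> 3" by (rule exp_le)
  finally have q3: "q ^ (k - 1) \<le> 3" .
  have "A (k - 1) \<le> (real (k - 1) + 1) * q ^ (k - 1) * W" using ind[of "k - 1"] assms(3) by simp
  also have "\<dots> = real k * q ^ (k - 1) * W" using assms(3) by (simp add: of_nat_diff)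
  also have "\<dots> \<le> real k * 3 * W" using q3 assms by (intro mult_right_mono mult_left_mono) auto
  finally show ?thesis by (simp add: mult.commute)
qed

text \<open>Turns the constants \<open>D\<close> of \<open>alternating_blocks_moment\<close> into a
  function of \<open>k\<close>, which enters the error sequence \<open>F\<close> of the
  recursion.\<close>

lemma uniform_choice:
  "\<forall>k\<ge>1 :: nat. \<exists>D\<ge>0 :: real. Q k D \<Longrightarrow> \<exists>D. \<forall>k\<ge>1. D k \<ge> 0 \<and> Q k (D k)"
  by metis

section \<open>Moments of sums over alternating blocks\<close>

context decorrelated_map
begin

lemma funpow_T_add: "(T ^^ (a + b)) x = (T ^^ b) ((T ^^ a) x)"
  by (metis add.commute comp_apply funpow_add)

text \<open>The length \<open>(2 * j + 1) * m\<close> counts \<open>j + 1\<close> blocks and the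
  \<open>j\<close> gaps between them.\<close>

lemma alternating_blocks_sep_obs:
  assumes h: "sep_obs m B L h"
  shows "\<exists>f. sep_obs ((2 * j + 1) * m) (real (j + 1) * B) L f \<and>
    (\<forall>x. f (orbit ((2 * j + 1) * m) x) = (\<Sum>l\<le>j. h (orbit m ((T ^^ (2 * l * m)) x))))"
proof (induction j)
  case 0
  show ?case using h by (intro exI[of _ h]) auto
next
  case (Suc j)
  then obtain f where f: "sep_obs ((2 * j + 1) * m) (real (j + 1) * B) L f"
    "\<And>x. f (orbit ((2 * j + 1) * m) x) = (\<Sum>l\<le>j. h (orbit m ((T ^^ (2 * l * m)) x)))"
    by blast
  have N: "(2 * Suc j + 1) * m = (2 * j + 1) * m + m + m" and N': "(2 * j + 1) * m + m = 2 * Suc j * m"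
    by (simp_all add: algebra_simps)
  have B: "real (Suc j + 1) * B = real (j + 1) * B + B" by (simp add: algebra_simps)
  have "append_obs ((2 * j + 1) * m) m m f h (orbit ((2 * j + 1) * m + m + m) x)
      = (\<Sum>l\<le>Suc j. h (orbit m ((T ^^ (2 * l * m)) x)))" for x
    using append_obs_orbit[of "(2 * j + 1) * m" m m f h x] by (simp only: f(2) N' sum.atMost_Suc)
  then show ?case unfolding N B using sep_obs_append[OF f(1) h, of m] by blast
qed

text \<open>The order of the quantifiers is the point: \<open>K\<close>, the factor of the block
  moment, precedes \<open>k\<close>, while \<open>D\<close> may depend on \<open>k\<close>. Both are
  uniform in the block length and in the observable.\<close>

lemma alternating_blocks_moment:
  assumes p: "p > 1"
  shows "\<exists>K\<ge>1. \<forall>k\<ge>1. \<exists>D\<ge>0. (\<forall>m h B L s. m \<ge> 1 \<longrightarrow> sep_obs m B L h \<longrightarrow> expectation (\<lambda>x. h (orbit m x)) = 0 \<longrightarrow>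
       s \<ge> 0 \<longrightarrow> (p > 2 \<longrightarrow> expectation (\<lambda>x. (h (orbit m x))\<^sup>2) \<le> s) \<longrightarrow>
       expectation (\<lambda>x. \<bar>\<Sum>l<k. h (orbit m ((T ^^ (2 * l * m)) x))\<bar> powr p)
         \<le> 3 * real k * (K * expectation (\<lambda>x. \<bar>h (orbit m x)\<bar> powr p) + D * s powr (p / 2)
             + C * real m powr (- \<gamma>) * ((real k * B) powr p + real (2 * k * m) * (p * (real k * B) powr (p - 1) * L))))"
proof -
  from moment_shift_le[OF p] obtain K where K: "K \<ge> 1" and shift:
    "\<And>\<delta>. \<delta> > 0 \<Longrightarrow> \<exists>D\<ge>0. \<forall>Z B s a. Z \<in> borel_measurable \<mu> \<longrightarrow> (\<forall>x. \<bar>Z x\<bar> \<le> B) \<longrightarrow> expectation Z = 0 \<longrightarrow>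
       s \<ge> 0 \<longrightarrow> (p > 2 \<longrightarrow> expectation (\<lambda>x. (Z x)\<^sup>2) \<le> s) \<longrightarrow>
       expectation (\<lambda>x. \<bar>a + Z x\<bar> powr p)
         \<le> (1 + \<delta>) * \<bar>a\<bar> powr p + K * expectation (\<lambda>x. \<bar>Z x\<bar> powr p) + D * s powr (p / 2)"
    by blast
  show ?thesis
  proof (rule exI[of _ K], rule conjI[OF K], intro allI impI)
    fix k :: nat assume k: "k \<ge> 1"
    \<comment> \<open>The choice \<open>\<delta> = 1/k\<close> matches
      \<open>affine_recursion_bound\<close>; it makes \<open>D\<close> depend on
      \<open>k\<close>.\<close>
    have "1 / real k > 0" using k by simp
    from shift[OF this] obtain D where D: "D \<ge> 0" and shift:
      "\<forall>Z B s a. Z \<in> borel_measurable \<mu> \<longrightarrow> (\<forall>x. \<bar>Z x\<bar> \<le> B) \<longrightarrow> expectation Z = 0 \<longrightarrow>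
       s \<ge> 0 \<longrightarrow> (p > 2 \<longrightarrow> expectation (\<lambda>x. (Z x)\<^sup>2) \<le> s) \<longrightarrow>
       expectation (\<lambda>x. \<bar>a + Z x\<bar> powr p)
         \<le> (1 + 1 / real k) * \<bar>a\<bar> powr p + K * expectation (\<lambda>x. \<bar>Z x\<bar> powr p) + D * s powr (p / 2)"
      by blast
    show "\<exists>D\<ge>0. \<forall>m h B L s. m \<ge> 1 \<longrightarrow> sep_obs m B L h \<longrightarrow> expectation (\<lambda>x. h (orbit m x)) = 0 \<longrightarrow>
       s \<ge> 0 \<longrightarrow> (p > 2 \<longrightarrow> expectation (\<lambda>x. (h (orbit m x))\<^sup>2) \<le> s) \<longrightarrow>
       expectation (\<lambda>x. \<bar>\<Sum>l<k. h (orbit m ((T ^^ (2 * l * m)) x))\<bar> powr p)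
         \<le> 3 * real k * (K * expectation (\<lambda>x. \<bar>h (orbit m x)\<bar> powr p) + D * s powr (p / 2)
             + C * real m powr (- \<gamma>) * ((real k * B) powr p + real (2 * k * m) * (p * (real k * B) powr (p - 1) * L)))"
    proof (intro exI[of _ D] conjI D allI impI)
      fix m :: nat and h B L and s :: real
      assume m: "m \<ge> 1" and h: "sep_obs m B L h" and h0: "expectation (\<lambda>x. h (orbit m x)) = 0"
        and s: "s \<ge> 0" and h2: "p > 2 \<longrightarrow> expectation (\<lambda>x. (h (orbit m x))\<^sup>2) \<le> s"
      note [measurable] = sep_obsD(1)[OF h]
      note B0 = sep_obs_nonneg[OF h] and L0 = sep_obsD(2)[OF h]
      \<comment> \<open>\<open>A j\<close> involves \<open>j + 1\<close> blocks, so the sum over all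
        \<open>k\<close> blocks is reached at index \<open>k - 1\<close>.\<close>
      define A where "A j = expectation (\<lambda>x. \<bar>\<Sum>l\<le>j. h (orbit m ((T ^^ (2 * l * m)) x))\<bar> powr p)" for j
      define E where "E = expectation (\<lambda>x. \<bar>h (orbit m x)\<bar> powr p)"
      define Q where "Q = C * real m powr (- \<gamma>)
        * ((real k * B) powr p + real (2 * k * m) * (p * (real k * B) powr (p - 1) * L))"
      have Q0: "Q \<ge> 0" using C_pos p L0 by (auto simp: Q_def)
      have E0: "E \<ge> 0" by (simp add: E_def)
      have KE: "E \<le> K * E" using mult_right_mono[OF K E0] by simp
      have "A (k - 1) \<le> 3 * real k * (K * E + D * s powr (p / 2) + Q)"
      proof (rule affine_recursion_bound[OF _ _ k])
        show "0 \<le> K * E + D * s powr (p / 2) + Q" using KE E0 Q0 D by (auto intro!: add_nonneg_nonneg)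
        have "A 0 = E" by (simp add: A_def E_def)
        then show "A 0 \<le> K * E + D * s powr (p / 2) + Q" using KE Q0 D
          by (auto intro!: add_increasing2)
        fix j assume j: "Suc j < k"
        define N where "N = (2 * j + 1) * m"
        obtain f where f: "sep_obs N (real (j + 1) * B) L f"
          "\<And>x. f (orbit N x) = (\<Sum>l\<le>j. h (orbit m ((T ^^ (2 * l * m)) x)))"
          using alternating_blocks_sep_obs[OF h] unfolding N_def by blast
        note [measurable] = sep_obsD(1)[OF f(1)]
        have N: "N + m = 2 * Suc j * m" and N1: "N \<ge> 1" using m by (simp_all add: N_def algebra_simps)
        have "A (Suc j) = expectation (\<lambda>x. \<bar>f (orbit N x) + h (orbit m ((T ^^ (N + m)) x))\<bar> powr p)"
          by (simp only: A_def f(2) N sum.atMost_Suc)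
        also have "\<dots> \<le> expectation (\<lambda>x. expectation (\<lambda>y. \<bar>f (orbit N x) + h (orbit m y)\<bar> powr p))
            + C * real m powr (- \<gamma>) * ((real (j + 1) * B + B) powr p
              + real (N + m) * (p * (real (j + 1) * B + B) powr (p - 1) * L))"
          using m N1 by (intro decorrelate_moment p f h) auto
        \<comment> \<open>Each decorrelation error is dominated by the one for the full length,
          because \<open>j + 2 \<le> k\<close> blocks are involved.\<close>
        also have "C * real m powr (- \<gamma>) * ((real (j + 1) * B + B) powr p
              + real (N + m) * (p * (real (j + 1) * B + B) powr (p - 1) * L)) \<le> Q"
        proof -
          have "real (j + 1) * B + B = real (j + 2) * B" by (simp add: algebra_simps)
          also have "\<dots> \<le> real k * B" using j B0 by (intro mult_right_mono) auto
          finally have B: "real (j + 1) * B + B \<le> real k * B" .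
          have N': "real (N + m) \<le> real (2 * k * m)" unfolding N using j
            by (intro of_nat_mono mult_le_mono) auto
          show ?thesis unfolding Q_def using B N' C_pos p L0 B0
            by (intro mult_left_mono add_mono mult_mono powr_mono2 mult_nonneg_nonneg) auto
        qed
        also have "expectation (\<lambda>x. expectation (\<lambda>y. \<bar>f (orbit N x) + h (orbit m y)\<bar> powr p))
            \<le> expectation (\<lambda>x. (1 + 1 / real k) * \<bar>f (orbit N x)\<bar> powr p + (K * E + D * s powr (p / 2)))"
        proof (rule integral_mono)
          have "\<bar>f (orbit N x) + h (orbit m y)\<bar> powr p \<le> (real (j + 1) * B + B) powr p" for x y
            using sep_obsD(3)[OF f(1), of "orbit N x"] sep_obsD(3)[OF h, of "orbit m y"] p
            by (intro powr_mono2) auto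
          then have "integrable \<mu> (\<lambda>y. \<bar>f (orbit N x) + h (orbit m y)\<bar> powr p)"
            "expectation (\<lambda>y. \<bar>f (orbit N x) + h (orbit m y)\<bar> powr p) \<le> (real (j + 1) * B + B) powr p" for x
            by (auto intro!: integrable_bounded[of _ "(real (j + 1) * B + B) powr p"] integral_le_const)
          then show "integrable \<mu> (\<lambda>x. expectation (\<lambda>y. \<bar>f (orbit N x) + h (orbit m y)\<bar> powr p))"
            by (intro integrable_bounded[of _ "(real (j + 1) * B + B) powr p"]) auto
          have "\<bar>f (orbit N x)\<bar> powr p \<le> (real (j + 1) * B) powr p" for x
            using sep_obsD(3)[OF f(1), of "orbit N x"] p by (intro powr_mono2) auto
          then have "integrable \<mu> (\<lambda>x. \<bar>f (orbit N x)\<bar> powr p)"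
            by (intro integrable_bounded[of _ "(real (j + 1) * B) powr p"]) auto
          then show "integrable \<mu> (\<lambda>x. (1 + 1 / real k) * \<bar>f (orbit N x)\<bar> powr p + (K * E + D * s powr (p / 2)))"
            by auto
          \<comment> \<open>For fixed \<open>x\<close> the past sum \<open>f (orbit N x)\<close> is
            the constant \<open>a\<close> of the shift inequality.\<close>
          fix x
          show "expectation (\<lambda>y. \<bar>f (orbit N x) + h (orbit m y)\<bar> powr p)
             \<le> (1 + 1 / real k) * \<bar>f (orbit N x)\<bar> powr p + (K * E + D * s powr (p / 2))"
            using shift[rule_format, of "\<lambda>x. h (orbit m x)" B s "f (orbit N x)"] sep_obsD(3)[OF h] h0 s h2
            by (simp add: E_def add.assoc)
        qed
        also have "\<dots> = (1 + 1 / real k) * A j + (K * E + D * s powr (p / 2))"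
        proof -
          have "\<bar>f (orbit N x)\<bar> powr p \<le> (real (j + 1) * B) powr p" for x
            using sep_obsD(3)[OF f(1), of "orbit N x"] p by (intro powr_mono2) auto
          then have "integrable \<mu> (\<lambda>x. \<bar>f (orbit N x)\<bar> powr p)"
            by (intro integrable_bounded[of _ "(real (j + 1) * B) powr p"]) auto
          then show ?thesis by (simp add: prob_space A_def flip: f(2))
        qed
        finally show "A (Suc j) \<le> (1 + 1 / real k) * A j + (K * E + D * s powr (p / 2) + Q)" by simp
      qed
      moreover have "{..k - 1} = {..<k}" using k by auto
      ultimately show "expectation (\<lambda>x. \<bar>\<Sum>l<k. h (orbit m ((T ^^ (2 * l * m)) x))\<bar> powr p)
         \<le> 3 * real k * (K * expectation (\<lambda>x. \<bar>h (orbit m x)\<bar> powr p) + D * s powr (p / 2)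
             + C * real m powr (- \<gamma>) * ((real k * B) powr p + real (2 * k * m) * (p * (real k * B) powr (p - 1) * L)))"
        by (simp add: A_def E_def Q_def)
    qed
  qed
qed

text \<open>The condition \<open>a * p \<le> \<gamma> + \<tau>\<close> makes the decorrelation error \<open>m powr (- \<gamma>) * (m ^ a) powr p\<close>
  at most \<open>m powr \<tau>\<close>.\<close>

lemma block_moment_bound:
  fixes a :: nat and E :: "nat \<Rightarrow> real"
  assumes p: "p > 1" and \<tau>: "\<tau> > 1" and c: "c \<ge> 0" and a: "a \<ge> 1" "real a * p \<le> \<gamma> + \<tau>"
  shows "\<exists>A>0. \<forall>h. (\<forall>m\<ge>1. sep_obs m (c * real m ^ a) (c * real m ^ (a - 1)) (h m) \<and>
        expectation (\<lambda>x. h m (orbit m x)) = 0 \<and>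
        (p > 2 \<longrightarrow> expectation (\<lambda>x. (h m (orbit m x))\<^sup>2) \<le> c * real m powr (2 * \<tau> / p))) \<longrightarrow>
     (\<forall>k\<ge>1. \<forall>n\<ge>2 * k. let m = n div (2 * k) in
        expectation (\<lambda>x. \<bar>h n (orbit n x) - (\<Sum>i<2 * k. h m (orbit m ((T ^^ (i * m)) x)))\<bar> powr p)
          \<le> E k * real n powr \<tau>) \<longrightarrow>
     (\<forall>n\<ge>1. expectation (\<lambda>x. \<bar>h n (orbit n x)\<bar> powr p) \<le> A * real n powr \<tau>)"
proof -
  obtain K where K': "K \<ge> 1 \<and> (\<forall>k\<ge>1. \<exists>D\<ge>0. (\<forall>m h B L s. m \<ge> 1 \<longrightarrow> sep_obs m B L h \<longrightarrow> expectation (\<lambda>x. h (orbit m x)) = 0 \<longrightarrow>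
       s \<ge> 0 \<longrightarrow> (p > 2 \<longrightarrow> expectation (\<lambda>x. (h (orbit m x))\<^sup>2) \<le> s) \<longrightarrow>
       expectation (\<lambda>x. \<bar>\<Sum>l<k. h (orbit m ((T ^^ (2 * l * m)) x))\<bar> powr p)
         \<le> 3 * real k * (K * expectation (\<lambda>x. \<bar>h (orbit m x)\<bar> powr p) + D * s powr (p / 2)
             + C * real m powr (- \<gamma>) * ((real k * B) powr p + real (2 * k * m) * (p * (real k * B) powr (p - 1) * L)))))"
    using alternating_blocks_moment[OF p] by (rule exE)
  note K = conjunct1[OF K']
  obtain D where D': "\<forall>k\<ge>1. D k \<ge> 0 \<and> (\<forall>m h B L s. m \<ge> 1 \<longrightarrow> sep_obs m B L h \<longrightarrow> expectation (\<lambda>x. h (orbit m x)) = 0 \<longrightarrow>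
       s \<ge> 0 \<longrightarrow> (p > 2 \<longrightarrow> expectation (\<lambda>x. (h (orbit m x))\<^sup>2) \<le> s) \<longrightarrow>
       expectation (\<lambda>x. \<bar>\<Sum>l<k. h (orbit m ((T ^^ (2 * l * m)) x))\<bar> powr p)
         \<le> 3 * real k * (K * expectation (\<lambda>x. \<bar>h (orbit m x)\<bar> powr p) + D k * s powr (p / 2)
             + C * real m powr (- \<gamma>) * ((real k * B) powr p + real (2 * k * m) * (p * (real k * B) powr (p - 1) * L))))"
    using uniform_choice[OF conjunct2[OF K']] by (rule exE)
  have D: "D k \<ge> 0" if "k \<ge> 1" for k using D' that by simp
  note blocks = D'[rule_format, THEN conjunct2]
  \<comment> \<open>One factor \<open>2 powr p\<close> splits off the remainder,
    \<open>2 powr p * 2\<close> joins even and odd blocks, whose moments agree by invariance, and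
    \<open>3\<close> comes from \<open>affine_recursion_bound\<close>.\<close>
  define P where "P = 2 powr p * (2 powr p * 2) * 3"
  \<comment> \<open>The terms that do not contain the shorter block moment: variance, decorrelation
    error and remainder, each divided by \<open>n powr \<tau>\<close>.\<close>
  define F where "F k = P * real k * (D k * c powr (p / 2)
      + C * ((real k * c) powr p + 2 * real k * p * (real k * c) powr (p - 1) * c)) + 2 powr p * E k" for k
  have P0: "P \<ge> 0" by (simp add: P_def)
  have cpos: "0 \<le> c powr p" by simp
  have PK: "P * K \<ge> 0" using P0 K by simp
  have ap: "real a * p \<ge> 0" using p by simp
  obtain A where A': "A > 0 \<and> (\<forall>b. (\<forall>k\<ge>1. \<forall>n\<ge>2 * k.
       b n \<le> P * K * real k * b (n div (2 * k)) + F k * real n powr \<tau>) \<longrightarrow>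
     (\<forall>n\<ge>1. b n \<le> c powr p * real n powr (real a * p)) \<longrightarrow> (\<forall>n\<ge>1. b n \<le> A * real n powr \<tau>))"
    using division_recursion_bound[OF \<tau> PK cpos ap, of F] by (rule exE)
  note A = conjunct1[OF A'] conjunct2[OF A', rule_format]
  show ?thesis
  proof (rule exI[of _ A], rule conjI[OF A(1)], intro allI impI)
    fix h and n0 :: nat
    assume hm: "\<forall>m\<ge>1. sep_obs m (c * real m ^ a) (c * real m ^ (a - 1)) (h m) \<and>
        expectation (\<lambda>x. h m (orbit m x)) = 0 \<and>
        (p > 2 \<longrightarrow> expectation (\<lambda>x. (h m (orbit m x))\<^sup>2) \<le> c * real m powr (2 * \<tau> / p))"
      and rem: "\<forall>k\<ge>1. \<forall>n\<ge>2 * k. let m = n div (2 * k) in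
        expectation (\<lambda>x. \<bar>h n (orbit n x) - (\<Sum>i<2 * k. h m (orbit m ((T ^^ (i * m)) x)))\<bar> powr p)
          \<le> E k * real n powr \<tau>"
      and n0: "n0 \<ge> 1"
    have h: "sep_obs m (c * real m ^ a) (c * real m ^ (a - 1)) (h m)"
      and h0: "expectation (\<lambda>x. h m (orbit m x)) = 0"
      and h2: "p > 2 \<Longrightarrow> expectation (\<lambda>x. (h m (orbit m x))\<^sup>2) \<le> c * real m powr (2 * \<tau> / p)"
      if "m \<ge> 1" for m
      using hm that by auto
    define b where "b n = expectation (\<lambda>x. \<bar>h n (orbit n x)\<bar> powr p)" for n
    have bnd: "\<bar>h n (orbit n x)\<bar> powr p \<le> c powr p * real n powr (real a * p)" if "n \<ge> 1" for n x
    proof -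
      have "\<bar>h n (orbit n x)\<bar> powr p \<le> (c * real n ^ a) powr p"
        using sep_obsD(3)[OF h[OF that], of "orbit n x"] p by (intro powr_mono2) auto
      also have "\<dots> = c powr p * real n powr (real a * p)"
        using c that by (simp add: powr_mult powr_powr flip: powr_realpow)
      finally show ?thesis .
    qed
    have "b n0 \<le> A * real n0 powr \<tau>"
    proof (rule A(2)[OF _ _ n0])
      fix n :: nat assume n: "n \<ge> 1"
      note [measurable] = sep_obsD(1)[OF h[OF n]]
      show "b n \<le> c powr p * real n powr (real a * p)"
        unfolding b_def using bnd[OF n]
        by (intro integral_le_const integrable_bounded[of _ "c powr p * real n powr (real a * p)"]) auto
    next
      fix k n :: nat assume k: "k \<ge> 1" and n: "n \<ge> 2 * k"
      define m where "m = n div (2 * k)"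
      have m: "m \<ge> 1" unfolding m_def using k n
        by (metis One_nat_def Suc_leI div_greater_zero_iff mult_pos_pos pos2 zero_less_one_class.zero_less_one order_less_le_trans)
      have n1: "n \<ge> 1" using k n by simp
      have mn: "real m \<le> real n" by (simp add: m_def)
      note [measurable] = sep_obsD(1)[OF h[OF m]] sep_obsD(1)[OF h[OF n1]]
      \<comment> \<open>\<open>U\<close> collects the even blocks; the odd ones are \<open>U\<close>
        shifted by \<open>m\<close>. The remainder \<open>V\<close> is whatever the block
        decomposition of \<open>h n\<close> leaves over.\<close>
      define U where "U x = (\<Sum>l<k. h m (orbit m ((T ^^ (2 * l * m)) x)))" for x
      define V where "V x = h n (orbit n x) - (\<Sum>i<2 * k. h m (orbit m ((T ^^ (i * m)) x)))" for x
      have [measurable]: "U \<in> borel_measurable \<mu>" "V \<in> borel_measurable \<mu>"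
        unfolding U_def V_def by measurable
      have hm: "\<bar>h m (orbit m x)\<bar> \<le> c * real m ^ a" for x by (rule sep_obsD(3)[OF h[OF m]])
      have U: "\<bar>U x\<bar> \<le> real k * (c * real m ^ a)" for x
        using sum_norm_bound[of "{..<k}" "\<lambda>l. h m (orbit m ((T ^^ (2 * l * m)) x))" "c * real m ^ a"] hm
        by (simp add: U_def)
      have V: "\<bar>V x\<bar> \<le> c * real n ^ a + real (2 * k) * (c * real m ^ a)" for x
      proof -
        have "\<bar>\<Sum>i<2 * k. h m (orbit m ((T ^^ (i * m)) x))\<bar> \<le> real (2 * k) * (c * real m ^ a)"
          using sum_norm_bound[of "{..<2 * k}" "\<lambda>l. h m (orbit m ((T ^^ (l * m)) x))" "c * real m ^ a"] hm
          by simp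
        then show ?thesis using sep_obsD(3)[OF h[OF n1], of "orbit n x"] unfolding V_def by linarith
      qed
      have powr_int: "integrable \<mu> (\<lambda>x. \<bar>W x\<bar> powr p)"
        if [measurable]: "W \<in> borel_measurable \<mu>" and "\<And>x. \<bar>W x\<bar> \<le> B" for W B
      proof -
        have "\<bar>W x\<bar> powr p \<le> B powr p" for x using that(2)[of x] p by (intro powr_mono2) auto
        then show ?thesis by (intro integrable_bounded[of _ "B powr p"]) auto
      qed
      have intU: "integrable \<mu> (\<lambda>x. \<bar>U x\<bar> powr p)" using U by (intro powr_int) auto
      have intU': "integrable \<mu> (\<lambda>x. \<bar>U ((T ^^ m) x)\<bar> powr p)" using U by (intro powr_int) auto
      have intV: "integrable \<mu> (\<lambda>x. \<bar>V x\<bar> powr p)" using V by (intro powr_int) auto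
      have dec: "h n (orbit n x) = (U x + U ((T ^^ m) x)) + V x" for x
      proof -
        have "(\<Sum>i<2 * k. h m (orbit m ((T ^^ (i * m)) x))) = U x + U ((T ^^ m) x)"
          unfolding sum_even_odd U_def by (simp add: funpow_T_add)
        then show ?thesis by (simp add: V_def)
      qed
      have pw: "\<bar>h n (orbit n x)\<bar> powr p \<le> 2 powr p * (2 powr p * (\<bar>U x\<bar> powr p + \<bar>U ((T ^^ m) x)\<bar> powr p) + \<bar>V x\<bar> powr p)" for x
      proof -
        have "\<bar>h n (orbit n x)\<bar> powr p \<le> 2 powr p * (\<bar>U x + U ((T ^^ m) x)\<bar> powr p + \<bar>V x\<bar> powr p)"
          unfolding dec using p by (intro abs_powr_add_le) auto
        also have "\<dots> \<le> 2 powr p * (2 powr p * (\<bar>U x\<bar> powr p + \<bar>U ((T ^^ m) x)\<bar> powr p) + \<bar>V x\<bar> powr p)"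
          using p by (intro mult_left_mono add_right_mono abs_powr_add_le) auto
        finally show ?thesis .
      qed
      have "b n \<le> expectation (\<lambda>x. 2 powr p * (2 powr p * (\<bar>U x\<bar> powr p + \<bar>U ((T ^^ m) x)\<bar> powr p) + \<bar>V x\<bar> powr p))"
        unfolding b_def using sep_obsD(3)[OF h[OF n1]] intU intU' intV
        by (intro integral_mono pw powr_int) auto
      also have "\<dots> = 2 powr p * (2 powr p * (2 * expectation (\<lambda>x. \<bar>U x\<bar> powr p)) + expectation (\<lambda>x. \<bar>V x\<bar> powr p))"
        using intU intU' intV expectation_funpow[of "\<lambda>x. \<bar>U x\<bar> powr p" m] by simp
      also have "\<dots> \<le> 2 powr p * (2 powr p * (2 * (3 * real k * (K * b m + (D k * c powr (p / 2)
             + C * ((real k * c) powr p + 2 * real k * p * (real k * c) powr (p - 1) * c)) * real n powr \<tau>))) + E k * real n powr \<tau>)"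
      proof (intro mult_left_mono add_mono)
        show "expectation (\<lambda>x. \<bar>V x\<bar> powr p) \<le> E k * real n powr \<tau>"
          using rem[rule_format, OF k n] by (simp add: V_def m_def Let_def)
        let ?B = "c * real m ^ a" and ?L = "c * real m ^ (a - 1)"
        have "expectation (\<lambda>x. \<bar>U x\<bar> powr p) \<le> 3 * real k * (K * b m + D k * (c * real m powr (2 * \<tau> / p)) powr (p / 2)
             + C * real m powr (- \<gamma>) * ((real k * ?B) powr p + real (2 * k * m) * (p * (real k * ?B) powr (p - 1) * ?L)))"
          unfolding U_def b_def
          using h[OF m] h0[OF m] h2[OF m] c by (intro blocks[OF k, rule_format] m) auto
        also have "\<dots> \<le> 3 * real k * (K * b m + (D k * c powr (p / 2)
             + C * ((real k * c) powr p + 2 * real k * p * (real k * c) powr (p - 1) * c)) * real n powr \<tau>)"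
        proof -
          have mt: "real m powr \<tau> \<le> real n powr \<tau>" using mn \<tau> by (intro powr_mono2) auto
          have "(c * real m powr (2 * \<tau> / p)) powr (p / 2) = c powr (p / 2) * real m powr \<tau>"
            using c p by (simp add: powr_mult powr_powr)
          then have 1: "D k * (c * real m powr (2 * \<tau> / p)) powr (p / 2) \<le> D k * c powr (p / 2) * real n powr \<tau>"
            using D[OF k] mt by (simp add: mult.assoc mult_left_mono)
          have ma: "real m ^ a = real m powr real a" using m by (simp add: powr_realpow)
          have kB: "(real k * ?B) powr q = (real k * c) powr q * real m powr (real a * q)" for q
            using c by (simp add: ma powr_mult powr_powr)
          \<comment> \<open>The oscillation constant has one degree less than the sup bound, but the
            number of coordinates is of order \<open>m\<close>. Both parts of the norm are therefore
            of order \<open>m powr (a * p)\<close>.\<close>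
          have "real m * real m ^ (a - 1) = real m ^ a" using a(1)
            by (metis power_eq_if not_one_le_zero)
          then have "real (2 * k * m) * (p * (real k * ?B) powr (p - 1) * ?L)
              = 2 * real k * p * (real k * c) powr (p - 1) * c * (real m powr (real a * (p - 1)) * real m ^ a)"
            unfolding kB by (simp add: mult_ac) 
          also have "real m powr (real a * (p - 1)) * real m ^ a = real m powr (real a * p)"
            unfolding ma by (simp add: algebra_simps flip: powr_add)
          finally have cross: "real (2 * k * m) * (p * (real k * ?B) powr (p - 1) * ?L)
              = 2 * real k * p * (real k * c) powr (p - 1) * c * real m powr (real a * p)" .
          have "real m powr (- \<gamma>) * ((real k * ?B) powr p + real (2 * k * m) * (p * (real k * ?B) powr (p - 1) * ?L))
             = ((real k * c) powr p + 2 * real k * p * (real k * c) powr (p - 1) * c) * (real m powr (- \<gamma>) * real m powr (real a * p))"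
            unfolding cross unfolding kB by (simp only: algebra_simps)
          also have "real m powr (- \<gamma>) * real m powr (real a * p) = real m powr (real a * p - \<gamma>)"
            by (simp add: algebra_simps flip: powr_add)
          also have "((real k * c) powr p + 2 * real k * p * (real k * c) powr (p - 1) * c) * real m powr (real a * p - \<gamma>)
             \<le> ((real k * c) powr p + 2 * real k * p * (real k * c) powr (p - 1) * c) * real n powr \<tau>"
          proof (intro mult_left_mono)
            have "real m powr (real a * p - \<gamma>) \<le> real m powr \<tau>" using a m by (intro powr_mono) auto
            then show "real m powr (real a * p - \<gamma>) \<le> real n powr \<tau>" using mt by simp
          qed (use c p in auto)
          finally have 2: "C * real m powr (- \<gamma>) * ((real k * ?B) powr p + real (2 * k * m) * (p * (real k * ?B) powr (p - 1) * ?L))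
            \<le> C * ((real k * c) powr p + 2 * real k * p * (real k * c) powr (p - 1) * c) * real n powr \<tau>"
            using C_pos by (simp add: mult.assoc)
          show ?thesis using 1 2 by (intro mult_left_mono) (auto simp: distrib_right)
        qed
        finally show "expectation (\<lambda>x. \<bar>U x\<bar> powr p) \<le> 3 * real k * (K * b m + (D k * c powr (p / 2)
             + C * ((real k * c) powr p + 2 * real k * p * (real k * c) powr (p - 1) * c)) * real n powr \<tau>)" .
      qed auto
      also have "\<dots> = P * K * real k * b m + F k * real n powr \<tau>"
        by (simp add: P_def F_def algebra_simps)
      finally show "b n \<le> P * K * real k * b (n div (2 * k)) + F k * real n powr \<tau>" by (simp add: m_def)
    qed
    then show "expectation (\<lambda>x. \<bar>h n0 (orbit n0 x)\<bar> powr p) \<le> A * real n0 powr \<tau>" by (simp add: b_def)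
  qed
qed

end

section \<open>Birkhoff sums and iterated sums\<close>

lemma birkhoff_sum_0 [simp]: "birkhoff_sum T v 0 x = 0"
  by (simp add: birkhoff_sum_def)

lemma birkhoff_sum_Suc: "birkhoff_sum T v (Suc n) x = birkhoff_sum T v n x + v ((T ^^ n) x)"
  by (simp add: birkhoff_sum_def)

lemma iterated_sum_0 [simp]: "iterated_sum T v w 0 x = 0"
  by (simp add: iterated_sum_def)

lemma iterated_sum_eq: "iterated_sum T v w n x = (\<Sum>j<n. \<Sum>i<j. v ((T ^^ i) x) * w ((T ^^ j) x))"
proof -
  have "iterated_sum T v w n x = (\<Sum>(j, i)\<in>Sigma {..<n} (\<lambda>j. {..<j}). v ((T ^^ i) x) * w ((T ^^ j) x))"
    unfolding iterated_sum_def
    by (rule sum.reindex_bij_witness[of _ "\<lambda>(j, i). (i, j)" "\<lambda>(i, j). (j, i)"]) auto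
  then show ?thesis by (simp add: sum.Sigma)
qed

lemma iterated_sum_Suc:
  "iterated_sum T v w (Suc n) x = iterated_sum T v w n x + birkhoff_sum T v n x * w ((T ^^ n) x)"
  by (simp add: iterated_sum_eq birkhoff_sum_def sum_distrib_right)

lemma birkhoff_sum_add:
  "birkhoff_sum T v (a + b) x = birkhoff_sum T v a x + birkhoff_sum T v b ((T ^^ a) x)"
proof (induction b)
  case (Suc b)
  have "(T ^^ (a + b)) x = (T ^^ b) ((T ^^ a) x)" by (metis add.commute comp_apply funpow_add)
  with Suc show ?case by (simp add: birkhoff_sum_Suc)
qed simp

text \<open>Chen's relation: a pair of times lies before \<open>a\<close>, lies after it, or
  straddles it, and the straddling pairs give the product.\<close>

lemma iterated_sum_add:
  "iterated_sum T v w (a + b) x = iterated_sum T v w a x + iterated_sum T v w b ((T ^^ a) x)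
     + birkhoff_sum T v a x * birkhoff_sum T w b ((T ^^ a) x)"
proof (induction b)
  case (Suc b)
  have "(T ^^ (a + b)) x = (T ^^ b) ((T ^^ a) x)" by (metis add.commute comp_apply funpow_add)
  with Suc show ?case
    by (simp add: iterated_sum_Suc birkhoff_sum_Suc birkhoff_sum_add algebra_simps)
qed simp

lemma birkhoff_sum_mult:
  "birkhoff_sum T v (j * m) x = (\<Sum>i<j. birkhoff_sum T v m ((T ^^ (i * m)) x))"
  by (induction j) (simp_all add: birkhoff_sum_add add.commute[of m])

text \<open>Chen's relation for consecutive blocks; each product couples a block with its entire
  past.\<close>

lemma iterated_sum_mult:
  "iterated_sum T v w (j * m) x = (\<Sum>i<j. iterated_sum T v w m ((T ^^ (i * m)) x))
     + (\<Sum>i<j. birkhoff_sum T v (i * m) x * birkhoff_sum T w m ((T ^^ (i * m)) x))"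
  by (induction j) (simp_all add: iterated_sum_add add.commute[of m])

text \<open>Diagonal and off-diagonal terms. It reduces the variance of a Birkhoff sum to the mean
  of an iterated sum.\<close>

lemma birkhoff_sum_square:
  fixes v :: "'a \<Rightarrow> real"
  shows "(birkhoff_sum T v n x)\<^sup>2 = (\<Sum>i<n. (v ((T ^^ i) x))\<^sup>2) + 2 * iterated_sum T v v n x"
  by (induction n) (simp_all add: birkhoff_sum_Suc iterated_sum_Suc power2_sum)

lemma abs_birkhoff_sum_le:
  assumes "\<And>x. \<bar>v x\<bar> \<le> 1"
  shows "\<bar>birkhoff_sum T v n x\<bar> \<le> real n"
  using sum_norm_bound[of "{..<n}" "\<lambda>i. v ((T ^^ i) x)" 1] assms by (simp add: birkhoff_sum_def)

lemma abs_double_sum_le: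
  fixes u :: "nat \<Rightarrow> nat \<Rightarrow> real"
  assumes "\<And>i j. \<bar>u i j\<bar> \<le> 1"
  shows "\<bar>\<Sum>j<n. \<Sum>i<j. u i j\<bar> \<le> (real n)\<^sup>2"
proof -
  have "\<bar>\<Sum>j<n. \<Sum>i<j. u i j\<bar> \<le> (\<Sum>j<n. real n)"
  proof (rule order_trans[OF sum_abs sum_mono])
    fix j assume j: "j \<in> {..<n}"
    have "\<bar>\<Sum>i<j. u i j\<bar> \<le> real j"
      using sum_norm_bound[of "{..<j}" "\<lambda>i. u i j" 1] assms by simp
    then show "\<bar>\<Sum>i<j. u i j\<bar> \<le> real n" using j by simp
  qed
  then show ?thesis by (simp add: power2_eq_square)
qed

lemma abs_mult_le_one: "\<bar>a :: real\<bar> \<le> 1 \<Longrightarrow> \<bar>b\<bar> \<le> 1 \<Longrightarrow> \<bar>a * b\<bar> \<le> 1"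
  using mult_mono[of "\<bar>a\<bar>" 1 "\<bar>b\<bar>" 1] by (simp add: abs_mult)

lemma abs_iterated_sum_le:
  assumes "\<And>x. \<bar>v x\<bar> \<le> 1" "\<And>x. \<bar>w x\<bar> \<le> 1"
  shows "\<bar>iterated_sum T v w n x\<bar> \<le> (real n)\<^sup>2"
  unfolding iterated_sum_eq by (intro abs_double_sum_le abs_mult_le_one assms)

section \<open>Covariances and moments of normalised observables\<close>

context decorrelated_map
begin

text \<open>Sup bound and oscillation constant are normalised to 1, so that every constant below is
  uniform in the observable; rescaling restores the norms in the theorem.\<close>

definition observable :: "('m \<Rightarrow> real) \<Rightarrow> bool" where
  "observable v \<longleftrightarrow> v \<in> borel_measurable \<mu> \<and> (\<forall>x. \<bar>v x\<bar> \<le> 1) \<and>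
     (\<forall>(z, z', r)\<in>R. \<bar>v z - v z'\<bar> \<le> r) \<and> expectation v = 0"

lemma observableD:
  assumes "observable v"
  shows "v \<in> borel_measurable \<mu>" "\<bar>v x\<bar> \<le> 1" "(z, z', r) \<in> R \<Longrightarrow> \<bar>v z - v z'\<bar> \<le> r" "expectation v = 0"
  using assms unfolding observable_def by (blast, blast, fast, blast)

lemma birkhoff_sum_measurable:
  assumes "observable v" shows "birkhoff_sum T v n \<in> borel_measurable \<mu>"
proof -
  note [measurable] = observableD(1)[OF assms]
  show ?thesis unfolding birkhoff_sum_def by measurable
qed

lemma iterated_sum_measurable:
  assumes "observable v" "observable w" shows "iterated_sum T v w n \<in> borel_measurable \<mu>"
proof -
  note [measurable] = observableD(1)[OF assms(1)] observableD(1)[OF assms(2)]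
  show ?thesis unfolding iterated_sum_eq by measurable
qed

text \<open>The correlation bound for two times and \<open>G\<close> the product of \<open>v\<close>
  and \<open>w\<close>. Its sup bound is 1 and its oscillation constant is 1 in both coordinates,
  which gives the factor 3; the decoupled integral is a product of zero means.\<close>

lemma covariance_bound:
  assumes v: "observable v" and w: "observable w" and ij: "i < j"
  shows "\<bar>expectation (\<lambda>x. v ((T ^^ i) x) * w ((T ^^ j) x))\<bar> \<le> 3 * C * real (j - i) powr (- \<gamma>)"
proof -
  define n :: "nat \<Rightarrow> nat" where "n k = (if k = 0 then i else j)" for k
  define G where "G x = v (x 0) * w (x (1 :: nat))" for x
  note [measurable] = observableD(1)[OF v] observableD(1)[OF w]
  note v1 = observableD(2)[OF v] and w1 = observableD(2)[OF w]
  have "\<bar>(\<integral>x. G (\<lambda>k\<in>{..<2}. (T ^^ n k) x) \<partial>\<mu>)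
         - (\<integral>(x\<^sub>0, x\<^sub>1). G (\<lambda>k\<in>{..<2}. (T ^^ n k) (if k < 1 then x\<^sub>0 else x\<^sub>1)) \<partial>(\<mu> \<Otimes>\<^sub>M \<mu>))\<bar>
        \<le> C * real (n 1 - n (1 - 1)) powr (- \<gamma>) * (1 + real 2 * 1)"
  proof (rule decorrelate)
    have "(\<lambda>x. x k) \<in> measurable (Pi\<^sub>M {..<2} (\<lambda>_. \<mu>)) \<mu>" if "k < 2" for k :: nat
      using that by (intro measurable_component_singleton) simp
    from this[of 0] this[of 1] show "G \<in> borel_measurable (Pi\<^sub>M {..<2} (\<lambda>_. \<mu>))"
      unfolding G_def by measurable
    show "\<bar>G x\<bar> \<le> 1" for x unfolding G_def by (intro abs_mult_le_one v1 w1)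
    fix k x z z' r assume k: "k < (2 :: nat)" and R: "(z, z', r) \<in> R"
    have "\<bar>v z - v z'\<bar> * \<bar>w y\<bar> \<le> r" "\<bar>v y\<bar> * \<bar>w z - w z'\<bar> \<le> r" for y
      using mult_mono[OF observableD(3)[OF v R] w1[of y]] mult_mono[OF v1[of y] observableD(3)[OF w R]]
        observableD(3)[OF v R] by auto
    then show "\<bar>G (x(k := z)) - G (x(k := z'))\<bar> \<le> 1 * r"
      using k by (cases "k = 0") (auto simp: G_def less_2_cases_iff abs_mult simp flip: left_diff_distrib right_diff_distrib)
  qed (use ij in \<open>auto simp: n_def mono_on_def\<close>)
  moreover have "(\<integral>(x\<^sub>0, x\<^sub>1). G (\<lambda>k\<in>{..<2}. (T ^^ n k) (if k < 1 then x\<^sub>0 else x\<^sub>1)) \<partial>(\<mu> \<Otimes>\<^sub>M \<mu>)) = 0"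
  proof -
    interpret P: pair_prob_space \<mu> \<mu> ..
    have "integrable (\<mu> \<Otimes>\<^sub>M \<mu>) (\<lambda>(x, y). v ((T ^^ i) x) * w ((T ^^ j) y))"
      by (intro P.P.integrable_const_bound[of _ 1]) (auto intro!: AE_I2 abs_mult_le_one v1 w1)
    from P.integral_fst'[OF this] have "(\<integral>(x, y). v ((T ^^ i) x) * w ((T ^^ j) y) \<partial>(\<mu> \<Otimes>\<^sub>M \<mu>)) = 0"
      using expectation_funpow[of w j] observableD(4)[OF w] by simp
    then show ?thesis by (simp add: G_def n_def)
  qed
  ultimately show ?thesis by (simp add: G_def n_def mult.commute mult.left_commute)
qed

text \<open>Bounds the total covariance of one time with all earlier ones; \<open>Suc d\<close> is
  the time difference, which is at least 1.\<close>

definition cov_const :: real where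
  "cov_const = 3 * C * (\<Sum>d. real (Suc d) powr (- \<gamma>))"

lemma summable_rate: "summable (\<lambda>d. real (Suc d) powr (- \<gamma>))"
  using rate summable_real_powr_iff[of "- \<gamma>"] by (subst summable_Suc_iff) auto

lemma cov_const_nonneg: "cov_const \<ge> 0"
  unfolding cov_const_def using C_pos by (intro mult_nonneg_nonneg suminf_nonneg summable_rate) auto

text \<open>For each later time the covariances with the earlier times are bounded by the whole
  series, uniformly in that time. The quadratic number of pairs thus has only a linear
  total.\<close>

lemma expectation_iterated_sum:
  assumes v: "observable v" and w: "observable w"
  shows "\<bar>expectation (iterated_sum T v w n)\<bar> \<le> cov_const * real n"
proof -
  note [measurable] = observableD(1)[OF v] observableD(1)[OF w]
  have int: "integrable \<mu> (\<lambda>x. v ((T ^^ i) x) * w ((T ^^ j) x))" for i j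
    by (intro integrable_bounded[of _ 1] abs_mult_le_one observableD(2)[OF v] observableD(2)[OF w]) measurable
  have "expectation (iterated_sum T v w n) = (\<Sum>j<n. \<Sum>i<j. expectation (\<lambda>x. v ((T ^^ i) x) * w ((T ^^ j) x)))"
    unfolding iterated_sum_eq using int by (simp add: Bochner_Integration.integral_sum)
  also have "\<bar>\<dots>\<bar> \<le> (\<Sum>j<n. cov_const)"
  proof (rule order_trans[OF sum_abs sum_mono])
    fix j
    have "\<bar>\<Sum>i<j. expectation (\<lambda>x. v ((T ^^ i) x) * w ((T ^^ j) x))\<bar>
      \<le> (\<Sum>i<j. 3 * C * real (Suc (j - Suc i)) powr (- \<gamma>))"
    proof (rule order_trans[OF sum_abs sum_mono])
      fix i assume "i \<in> {..<j}"
      then show "\<bar>expectation (\<lambda>x. v ((T ^^ i) x) * w ((T ^^ j) x))\<bar> \<le> 3 * C * real (Suc (j - Suc i)) powr (- \<gamma>)"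
        using covariance_bound[OF v w, of i j] by (simp add: Suc_diff_Suc)
    qed
    also have "\<dots> = (\<Sum>i<j. 3 * C * real (Suc i) powr (- \<gamma>))"
      by (rule sum.nat_diff_reindex)
    also have "\<dots> \<le> cov_const"
      unfolding cov_const_def sum_distrib_left[symmetric] using C_pos
      by (intro mult_left_mono sum_le_suminf summable_rate) auto
    finally show "\<bar>\<Sum>i<j. expectation (\<lambda>x. v ((T ^^ i) x) * w ((T ^^ j) x))\<bar> \<le> cov_const" .
  qed
  finally show ?thesis by (simp add: mult.commute)
qed

text \<open>Linear growth is the variance condition of \<open>block_moment_bound\<close> for
  \<open>p = 2 * q\<close> and \<open>\<tau> = q\<close>, where
  \<open>2 * \<tau> / p = 1\<close>.\<close>

lemma expectation_birkhoff_sum_square: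
  assumes v: "observable v"
  shows "expectation (\<lambda>x. (birkhoff_sum T v n x)\<^sup>2) \<le> (1 + 2 * cov_const) * real n"
proof -
  note [measurable] = observableD(1)[OF v]
  have v2: "(v y)\<^sup>2 \<le> 1" for y using power_mono[OF observableD(2)[OF v, of y], of 2] by simp
  have s2: "(\<Sum>i<n. (v ((T ^^ i) x))\<^sup>2) \<le> real n" for x
    using sum_mono[of "{..<n}" "\<lambda>i. (v ((T ^^ i) x))\<^sup>2" "\<lambda>_. 1"] v2 by simp
  have "integrable \<mu> (\<lambda>x. \<Sum>i<n. (v ((T ^^ i) x))\<^sup>2)"
    using s2 by (intro integrable_bounded[of _ "real n"]) (auto simp: sum_nonneg)
  moreover have "integrable \<mu> (iterated_sum T v v n)"
    by (intro integrable_bounded[of _ "(real n)\<^sup>2"] iterated_sum_measurable v abs_iterated_sum_le observableD(2)[OF v])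
  ultimately have "expectation (\<lambda>x. (birkhoff_sum T v n x)\<^sup>2)
      = expectation (\<lambda>x. \<Sum>i<n. (v ((T ^^ i) x))\<^sup>2) + 2 * expectation (iterated_sum T v v n)"
    unfolding birkhoff_sum_square by simp
  also have "expectation (\<lambda>x. \<Sum>i<n. (v ((T ^^ i) x))\<^sup>2) \<le> real n"
    using s2 by (intro integral_le_const \<open>integrable \<mu> (\<lambda>x. \<Sum>i<n. (v ((T ^^ i) x))\<^sup>2)\<close>) auto
  also have "expectation (iterated_sum T v v n) \<le> cov_const * real n"
    using expectation_iterated_sum[OF v v, of n] by linarith
  finally show ?thesis by (simp add: algebra_simps)
qed

text \<open>The exponents are written as in \<open>block_moment_bound\<close> with
  \<open>a = 1\<close>; the slack \<open>c \<ge> 1\<close> lets the variance constant serve here as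
  well. A coordinate occurs in one summand only.\<close>

lemma sep_obs_birkhoff:
  assumes v: "observable v" and c: "c \<ge> 1"
  shows "sep_obs m (c * real m ^ 1) (c * real m ^ (1 - 1)) (\<lambda>X. \<Sum>i<m. v (X i))"
  unfolding sep_obs_def
proof (intro conjI allI ballI, goal_cases)
  case 1
  have "(\<lambda>X. X i) \<in> measurable (Pi\<^sub>M {..<m} (\<lambda>_. \<mu>)) \<mu>" if "i \<in> {..<m}" for i
    using that by measurable
  then show ?case by (intro borel_measurable_sum measurable_compose[OF _ observableD(1)[OF v]])
next
  case (3 X)
  have "\<bar>\<Sum>i<m. v (X i)\<bar> \<le> real m"
    using sum_norm_bound[of "{..<m}" "\<lambda>i. v (X i)" 1] observableD(2)[OF v] by simp
  also have "\<dots> \<le> c * real m" using mult_right_mono[OF c, of "real m"] by simp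
  finally show ?case by simp
next
  case (4 i X t)
  obtain z z' r where t: "t = (z, z', r)" "(z, z', r) \<in> R" using 4 by (cases t) auto
  note vr = observableD(3)[OF v t(2)]
  have r: "0 \<le> r" using vr by linarith
  have "\<bar>(\<Sum>k<m. v ((X(i := z)) k)) - (\<Sum>k<m. v ((X(i := z')) k))\<bar>
      = \<bar>\<Sum>k<m. if k = i then v z - v z' else 0\<bar>"
    unfolding sum_subtractf[symmetric] by (intro arg_cong[of _ _ abs] sum.cong) auto
  also have "\<dots> \<le> r" using vr r by simp
  also have "\<dots> \<le> c * r" using mult_right_mono[OF c r] by simp
  finally show ?case by (simp add: t(1))
qed (use c in auto)

lemma birkhoff_sum_orbit: "(\<Sum>i<m. v (orbit m x i)) = birkhoff_sum T v m x"
  by (simp add: orbit_def birkhoff_sum_def)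

text \<open>\<open>block_moment_bound\<close> with \<open>a = 1\<close>, \<open>p = 2 * q\<close>
  and \<open>\<tau> = q\<close>; the condition \<open>a * p \<le> \<gamma> + \<tau>\<close> becomes
  \<open>q \<le> \<gamma>\<close>. Exponents below \<open>\<gamma>\<close> are included because
  iterated sums are also treated with \<open>q = 2\<close>.\<close>

lemma birkhoff_moment:
  assumes q: "1 < q" "q \<le> \<gamma>"
  shows "\<exists>A>0. \<forall>v. observable v \<longrightarrow> (\<forall>n. expectation (\<lambda>x. \<bar>birkhoff_sum T v n x\<bar> powr (2 * q)) \<le> A * real n powr q)"
proof -
  define c where "c = 1 + 2 * cov_const"
  have c: "c \<ge> 1" using cov_const_nonneg by (simp add: c_def)
  have q': "2 * q > 1" "q > 1" "0 \<le> c" "1 \<le> (1 :: nat)" "real 1 * (2 * q) \<le> \<gamma> + q" using q c by auto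
  obtain A where A': "A > 0 \<and> (\<forall>h. (\<forall>m\<ge>1. sep_obs m (c * real m ^ 1) (c * real m ^ (1 - 1)) (h m) \<and>
        expectation (\<lambda>x. h m (orbit m x)) = 0 \<and>
        (2 * q > 2 \<longrightarrow> expectation (\<lambda>x. (h m (orbit m x))\<^sup>2) \<le> c * real m powr (2 * q / (2 * q)))) \<longrightarrow>
     (\<forall>k\<ge>1. \<forall>n\<ge>2 * k. let m = n div (2 * k) in
        expectation (\<lambda>x. \<bar>h n (orbit n x) - (\<Sum>i<2 * k. h m (orbit m ((T ^^ (i * m)) x)))\<bar> powr (2 * q))
          \<le> real (2 * k) powr (2 * q) * real n powr q) \<longrightarrow>
     (\<forall>n\<ge>1. expectation (\<lambda>x. \<bar>h n (orbit n x)\<bar> powr (2 * q)) \<le> A * real n powr q))"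
    using block_moment_bound[OF q', of "\<lambda>k. real (2 * k) powr (2 * q)"] by (rule exE)
  show ?thesis
  proof (rule exI[of _ A], rule conjI[OF conjunct1[OF A']], intro allI impI)
    fix v and n :: nat assume v: "observable v"
    note [measurable] = observableD(1)[OF v]
    let ?h = "\<lambda>m X. \<Sum>i<m. v (X i)"
    have "\<forall>n\<ge>1. expectation (\<lambda>x. \<bar>?h n (orbit n x)\<bar> powr (2 * q)) \<le> A * real n powr q"
    proof ((rule conjunct2[OF A', THEN spec[of _ ?h], THEN mp, THEN mp]; intro allI impI), goal_cases)
      case (1 m)
      have "integrable \<mu> (\<lambda>x. v ((T ^^ i) x))" for i
        by (intro integrable_bounded[of _ 1] observableD(2)[OF v]) measurable
      then have "expectation (birkhoff_sum T v m) = 0"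
        unfolding birkhoff_sum_def using observableD(4)[OF v] by (simp add: expectation_funpow)
      then show ?case
        using expectation_birkhoff_sum_square[OF v, of m] sep_obs_birkhoff[OF v c, of m] 1 q
        by (simp add: birkhoff_sum_orbit c_def)
    next
      case (2 k n)
      define m where "m = n div (2 * k)"
      define s where "s = n mod (2 * k)"
      have n: "n = 2 * k * m + s" and s: "s < 2 * k" using 2 by (simp_all add: m_def s_def)
      \<comment> \<open>Only the incomplete block of length \<open>n mod (2 * k)\<close> is left,
        which is bounded pointwise by \<open>2 * k\<close>.\<close>
      have V: "birkhoff_sum T v n x - (\<Sum>i<2 * k. birkhoff_sum T v m ((T ^^ (i * m)) x))
          = birkhoff_sum T v s ((T ^^ (2 * k * m)) x)" for x
        unfolding n birkhoff_sum_add birkhoff_sum_mult by simp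
      have le: "\<bar>birkhoff_sum T v s ((T ^^ (2 * k * m)) x)\<bar> powr (2 * q) \<le> real (2 * k) powr (2 * q)" for x
        using abs_birkhoff_sum_le[of v T s "(T ^^ (2 * k * m)) x", OF observableD(2)[OF v]] s q
        by (intro powr_mono2) auto
      have meas[measurable]: "birkhoff_sum T v s \<in> borel_measurable \<mu>" by (rule birkhoff_sum_measurable[OF v])
      have "expectation (\<lambda>x. \<bar>birkhoff_sum T v s ((T ^^ (2 * k * m)) x)\<bar> powr (2 * q)) \<le> real (2 * k) powr (2 * q)"
        using le by (intro integral_le_const integrable_bounded[of _ "real (2 * k) powr (2 * q)"]) auto
      also have "\<dots> \<le> real (2 * k) powr (2 * q) * real n powr q"
        using 2 q mult_left_mono[of 1 "real n powr q" "real (2 * k) powr (2 * q)"]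
        by (simp add: ge_one_powr_ge_zero)
      finally show ?case unfolding birkhoff_sum_orbit m_def[symmetric] Let_def V .
    qed
    \<comment> \<open>The recursion covers \<open>n \<ge> 1\<close>; for \<open>n = 0\<close> both
      sides are zero.\<close>
    then show "expectation (\<lambda>x. \<bar>birkhoff_sum T v n x\<bar> powr (2 * q)) \<le> A * real n powr q"
      unfolding birkhoff_sum_orbit using q by (cases "n = 0") auto
  qed
qed


section \<open>Moments of centred and of plain iterated sums\<close>

text \<open>The cancellation in \<open>block_moment_bound\<close> requires mean zero blocks, but
  \<open>v\<close> and \<open>w\<close> at different times are correlated, so an iterated sum may
  have a nonzero mean.\<close>

definition centered_sum :: "('m \<Rightarrow> real) \<Rightarrow> ('m \<Rightarrow> real) \<Rightarrow> nat \<Rightarrow> 'm \<Rightarrow> real" where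
  "centered_sum v w n x = iterated_sum T v w n x - expectation (iterated_sum T v w n)"

lemma integrable_iterated_sum:
  assumes "observable v" "observable w" shows "integrable \<mu> (iterated_sum T v w n)"
  using assms by (intro integrable_bounded[of _ "(real n)\<^sup>2"] iterated_sum_measurable
    abs_iterated_sum_le observableD(2))

lemma abs_expectation_iterated_sum_le:
  assumes v: "observable v" and w: "observable w"
  shows "\<bar>expectation (iterated_sum T v w n)\<bar> \<le> (real n)\<^sup>2"
proof -
  have "\<bar>iterated_sum T v w n x\<bar> \<le> (real n)\<^sup>2" for x
    by (intro abs_iterated_sum_le observableD(2)[OF v] observableD(2)[OF w])
  then have b: "iterated_sum T v w n x \<le> (real n)\<^sup>2" "- ((real n)\<^sup>2) \<le> iterated_sum T v w n x" for x
    by (simp_all add: abs_le_iff minus_le_iff)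
  have "expectation (iterated_sum T v w n) \<le> (real n)\<^sup>2"
    by (intro integral_le_const integrable_iterated_sum v w AE_I2 b)
  moreover have "- ((real n)\<^sup>2) \<le> expectation (iterated_sum T v w n)"
    by (intro integral_ge_const integrable_iterated_sum v w AE_I2 b)
  ultimately show ?thesis by (simp add: abs_le_iff)
qed

text \<open>A coordinate occurs in fewer than \<open>m\<close> pairs as the earlier time and in
  fewer than \<open>m\<close> as the later one, so the oscillation is of order \<open>m\<close>. The
  sup bound \<open>2 * m\<^sup>2\<close> counts the double sum and the centring constant
  \<open>e\<close>.\<close>

lemma sep_obs_iterated:
  assumes v: "observable v" and w: "observable w" and c: "c \<ge> 2" and e: "\<bar>e\<bar> \<le> (real m)\<^sup>2"
  shows "sep_obs m (c * real m ^ 2) (c * real m ^ (2 - 1)) (\<lambda>X. (\<Sum>j<m. \<Sum>i<j. v (X i) * w (X j)) - e)"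
  unfolding sep_obs_def
proof (intro conjI allI ballI, goal_cases)
  case 1
  have "(\<lambda>X. X i) \<in> measurable (Pi\<^sub>M {..<m} (\<lambda>_. \<mu>)) \<mu>" if "i < m" for i
    using that by (intro measurable_component_singleton) simp
  then show ?case
    by (intro borel_measurable_diff borel_measurable_sum borel_measurable_times borel_measurable_const
        measurable_compose[OF _ observableD(1)[OF v]] measurable_compose[OF _ observableD(1)[OF w]]) auto
next
  case (3 X)
  have "\<bar>\<Sum>j<m. \<Sum>i<j. v (X i) * w (X j)\<bar> \<le> (real m)\<^sup>2"
    by (intro abs_double_sum_le abs_mult_le_one observableD(2)[OF v] observableD(2)[OF w])
  moreover have "2 * (real m)\<^sup>2 \<le> c * (real m)\<^sup>2" using c by (intro mult_right_mono) auto
  ultimately show ?case using e by linarith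
next
  case (4 l X t)
  obtain z z' r where t: "t = (z, z', r)" "(z, z', r) \<in> R" using 4 by (cases t) auto
  note vr = observableD(3)[OF v t(2)] and wr = observableD(3)[OF w t(2)]
  have r: "0 \<le> r" using vr by linarith
  let ?u = "\<lambda>z i j. v ((X(l := z)) i) * w ((X(l := z)) j)"
  have le: "\<bar>?u z i j - ?u z' i j\<bar> \<le> (if i = l then r else 0) + (if j = l then r else 0)" if "i < j" for i j
  proof -
    have "\<bar>v z - v z'\<bar> * \<bar>w y\<bar> \<le> r" "\<bar>v y\<bar> * \<bar>w z - w z'\<bar> \<le> r" for y
      using mult_mono[OF vr observableD(2)[OF w, of y]] mult_mono[OF observableD(2)[OF v, of y] wr] r by auto
    then show ?thesis
      using that r by (auto simp: abs_mult simp flip: left_diff_distrib right_diff_distrib)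
  qed
  have "\<bar>(\<Sum>j<m. \<Sum>i<j. ?u z i j) - (\<Sum>j<m. \<Sum>i<j. ?u z' i j)\<bar>
      = \<bar>\<Sum>j<m. \<Sum>i<j. ?u z i j - ?u z' i j\<bar>"
    by (simp only: sum_subtractf)
  also have "\<dots> \<le> (\<Sum>j<m. \<Sum>i<j. (if i = l then r else 0) + (if j = l then r else 0))"
    by (intro order_trans[OF sum_abs sum_mono] le) auto
  \<comment> \<open>For each \<open>j\<close>, the position \<open>i = l\<close> contributes at most
    once; the row \<open>j = l\<close> contributes \<open>j\<close> times.\<close>
  also have "\<dots> \<le> (\<Sum>j<m. r + (if j = l then real m * r else 0))"
  proof (intro sum_mono)
    fix j assume "j \<in> {..<m}"
    then have "real j * r \<le> real m * r" using r by (intro mult_right_mono) auto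
    then show "(\<Sum>i<j. (if i = l then r else 0) + (if j = l then r else 0)) \<le> r + (if j = l then real m * r else 0)"
      using r by (auto simp: sum.distrib)
  qed
  also have "\<dots> \<le> 2 * real m * r" using r by (simp add: sum.distrib)
  also have "\<dots> \<le> c * real m * r" using c r by (intro mult_right_mono) auto
  finally show ?case by (simp add: t(1))
qed (use c in auto)

lemma iterated_sum_orbit: "(\<Sum>j<m. \<Sum>i<j. v (orbit m x i) * w (orbit m x j)) = iterated_sum T v w m x"
  unfolding iterated_sum_eq orbit_def by (intro sum.cong) auto

lemma abs_mult_powr_le:
  "\<bar>a * b :: real\<bar> powr q \<le> (\<bar>a\<bar> powr (2 * q) + \<bar>b\<bar> powr (2 * q)) / 2"
proof -
  have sq: "(\<bar>y :: real\<bar> powr q)\<^sup>2 = \<bar>y\<bar> powr (2 * q)" for y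
    by (simp add: power2_eq_square flip: powr_add)
  show ?thesis
    using sum_squares_bound[of "\<bar>a\<bar> powr q" "\<bar>b\<bar> powr q"] by (simp add: sq abs_mult powr_mult)
qed

text \<open>The arithmetic-geometric mean inequality trades the \<open>q\<close>-th moment of a
  product for moments of order \<open>2 * q\<close> of Birkhoff sums, without using any
  decorrelation between the factors.\<close>

lemma birkhoff_product_moment:
  assumes v: "observable v" and w: "observable w" and q: "q > 1"
    and A: "\<And>v n. observable v \<Longrightarrow> expectation (\<lambda>x. \<bar>birkhoff_sum T v n x\<bar> powr (2 * q)) \<le> A * real n powr q"
    and mn: "m \<le> n" "k \<le> n" and A0: "A \<ge> 0"
  shows "integrable \<mu> (\<lambda>x. \<bar>birkhoff_sum T v k x * birkhoff_sum T w m ((T ^^ k) x)\<bar> powr q)"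
    and "expectation (\<lambda>x. \<bar>birkhoff_sum T v k x * birkhoff_sum T w m ((T ^^ k) x)\<bar> powr q) \<le> A * real n powr q"
proof -
  note [measurable] = birkhoff_sum_measurable[OF v] birkhoff_sum_measurable[OF w]
  have int: "integrable \<mu> (\<lambda>x. \<bar>birkhoff_sum T u l x\<bar> powr (2 * q))" if u: "observable u" for u l
  proof -
    note [measurable] = birkhoff_sum_measurable[OF u]
    have "\<bar>birkhoff_sum T u l x\<bar> powr (2 * q) \<le> real l powr (2 * q)" for x
      using abs_birkhoff_sum_le[OF observableD(2)[OF u]] q by (intro powr_mono2) auto
    then show ?thesis by (intro integrable_bounded[of _ "real l powr (2 * q)"]) auto
  qed
  have int': "integrable \<mu> (\<lambda>x. \<bar>birkhoff_sum T w m ((T ^^ k) x)\<bar> powr (2 * q))"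
  proof -
    have "\<bar>birkhoff_sum T w m ((T ^^ k) x)\<bar> powr (2 * q) \<le> real m powr (2 * q)" for x
      using abs_birkhoff_sum_le[OF observableD(2)[OF w]] q by (intro powr_mono2) auto
    then show ?thesis by (intro integrable_bounded[of _ "real m powr (2 * q)"]) auto
  qed
  have intr: "integrable \<mu> (\<lambda>x. (\<bar>birkhoff_sum T v k x\<bar> powr (2 * q) + \<bar>birkhoff_sum T w m ((T ^^ k) x)\<bar> powr (2 * q)) / 2)"
    using int[OF v] int' by auto
  show intl: "integrable \<mu> (\<lambda>x. \<bar>birkhoff_sum T v k x * birkhoff_sum T w m ((T ^^ k) x)\<bar> powr q)"
    using abs_mult_powr_le by (intro Bochner_Integration.integrable_bound[OF intr]) auto
  have "expectation (\<lambda>x. \<bar>birkhoff_sum T v k x * birkhoff_sum T w m ((T ^^ k) x)\<bar> powr q)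
      \<le> expectation (\<lambda>x. (\<bar>birkhoff_sum T v k x\<bar> powr (2 * q) + \<bar>birkhoff_sum T w m ((T ^^ k) x)\<bar> powr (2 * q)) / 2)"
    by (intro integral_mono intl intr abs_mult_powr_le)
  also have "\<dots> = (expectation (\<lambda>x. \<bar>birkhoff_sum T v k x\<bar> powr (2 * q))
        + expectation (\<lambda>x. \<bar>birkhoff_sum T w m x\<bar> powr (2 * q))) / 2"
    using int[OF v] int' expectation_funpow[of "\<lambda>x. \<bar>birkhoff_sum T w m x\<bar> powr (2 * q)" k] by simp
  also have "\<dots> \<le> (A * real n powr q + A * real n powr q) / 2"
  proof -
    have "A * real k powr q \<le> A * real n powr q" "A * real m powr q \<le> A * real n powr q"
      using mn A0 q by (auto intro!: mult_left_mono powr_mono2)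
    then show ?thesis using A[OF v, of k] A[OF w, of m] by simp
  qed
  finally show "expectation (\<lambda>x. \<bar>birkhoff_sum T v k x * birkhoff_sum T w m ((T ^^ k) x)\<bar> powr q) \<le> A * real n powr q"
    by simp
qed

text \<open>By Chen's relation the difference consists of the incomplete block, its product with the
  past, and the means. The first two are each at most \<open>2 * k * n\<close> since
  \<open>s < 2 * k\<close>; the means contribute \<open>cov_const * n\<close> twice.\<close>

lemma centered_block_remainder:
  assumes v: "observable v" and w: "observable w" and k: "k \<ge> 1" and n: "n = 2 * k * m + s" "s < 2 * k"
  shows "\<bar>centered_sum v w n x - (\<Sum>i<2 * k. centered_sum v w m ((T ^^ (i * m)) x))
      - (\<Sum>i<2 * k. birkhoff_sum T v (i * m) x * birkhoff_sum T w m ((T ^^ (i * m)) x))\<bar>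
    \<le> (4 * real k + 2 * cov_const) * real n"
proof -
  define y where "y = (T ^^ (2 * k * m)) x"
  have "centered_sum v w n x - (\<Sum>i<2 * k. centered_sum v w m ((T ^^ (i * m)) x))
      - (\<Sum>i<2 * k. birkhoff_sum T v (i * m) x * birkhoff_sum T w m ((T ^^ (i * m)) x))
    = iterated_sum T v w s y + birkhoff_sum T v (2 * k * m) x * birkhoff_sum T w s y
      - expectation (iterated_sum T v w n) + real (2 * k) * expectation (iterated_sum T v w m)"
    unfolding centered_sum_def n iterated_sum_add iterated_sum_mult y_def sum_subtractf by simp
  moreover have "\<bar>iterated_sum T v w s y\<bar> \<le> 2 * real k * real n"
  proof -
    have "\<bar>iterated_sum T v w s y\<bar> \<le> real s * real s"
      using abs_iterated_sum_le[of v w T s y, OF observableD(2)[OF v] observableD(2)[OF w]]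
        by (simp add: power2_eq_square)
    also have "\<dots> \<le> (2 * real k) * real n" using n by (intro mult_mono) auto
    finally show ?thesis .
  qed
  moreover have "\<bar>birkhoff_sum T v (2 * k * m) x * birkhoff_sum T w s y\<bar> \<le> 2 * real k * real n"
  proof -
    have "\<bar>birkhoff_sum T v (2 * k * m) x * birkhoff_sum T w s y\<bar> \<le> real (2 * k * m) * real s"
      unfolding abs_mult
      by (intro mult_mono abs_birkhoff_sum_le observableD(2)[OF v] observableD(2)[OF w]) auto
    also have "\<dots> \<le> real n * (2 * real k)" using n by (intro mult_mono) auto
    finally show ?thesis by (simp add: mult_ac)
  qed
  moreover have "\<bar>expectation (iterated_sum T v w n)\<bar> \<le> cov_const * real n"
    by (rule expectation_iterated_sum[OF v w])
  moreover have "\<bar>real (2 * k) * expectation (iterated_sum T v w m)\<bar> \<le> cov_const * real n"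
  proof -
    have "\<bar>real (2 * k) * expectation (iterated_sum T v w m)\<bar> \<le> real (2 * k) * (cov_const * real m)"
      unfolding abs_mult by (intro mult_mono expectation_iterated_sum v w) (auto simp: cov_const_nonneg)
    also have "\<dots> = cov_const * real (2 * k * m)" by simp
    also have "\<dots> \<le> cov_const * real n" using n cov_const_nonneg by (intro mult_left_mono of_nat_mono) auto
    finally show ?thesis .
  qed
  ultimately show ?thesis by (simp add: distrib_right)
qed

text \<open>\<open>block_moment_bound\<close> with \<open>a = 2\<close> and
  \<open>p = \<tau> = q\<close>, where \<open>a * p \<le> \<gamma> + \<tau>\<close> again means
  \<open>q \<le> \<gamma>\<close> and the variance condition is quadratic in \<open>m\<close>. The
  products of Birkhoff sums from Chen's relation are put into the remainder.\<close>

lemma centered_moment: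
  assumes q: "1 < q" "q \<le> \<gamma>" and B: "B \<ge> 0"
    and var: "\<And>v w m. q > 2 \<Longrightarrow> observable v \<Longrightarrow> observable w \<Longrightarrow> m \<ge> 1 \<Longrightarrow>
      expectation (\<lambda>x. (centered_sum v w m x)\<^sup>2) \<le> B * (real m)\<^sup>2"
  shows "\<exists>A>0. \<forall>v w. observable v \<longrightarrow> observable w \<longrightarrow>
    (\<forall>n\<ge>1. expectation (\<lambda>x. \<bar>centered_sum v w n x\<bar> powr q) \<le> A * real n powr q)"
proof -
  obtain A1 where A1: "A1 > 0"
    "\<And>v n. observable v \<Longrightarrow> expectation (\<lambda>x. \<bar>birkhoff_sum T v n x\<bar> powr (2 * q)) \<le> A1 * real n powr q"
    using birkhoff_moment[OF q] by blast
  define Q where "Q k = 4 * real k + 2 * cov_const" for k :: nat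
  have Q0: "Q k \<ge> 0" for k using cov_const_nonneg by (simp add: Q_def)
  \<comment> \<open>There are \<open>2 * k\<close> products, each with moment constant
    \<open>A1\<close>; \<open>real (2 * k) powr q\<close> comes from the power of their sum, and
    \<open>Q k\<close> bounds the rest pointwise.\<close>
  define E where "E k = 2 powr q * (real (2 * k) powr q * (real (2 * k) * A1) + Q k powr q)" for k :: nat
  \<comment> \<open>One constant for two demands: \<open>2\<close> for
    \<open>sep_obs_iterated\<close> and \<open>B\<close> for the variance.\<close>
  define c where "c = 2 + B"
  have c: "c \<ge> 2" "c \<ge> B" using B by (simp_all add: c_def)
  have q': "q > 1" "q > 1" "0 \<le> c" "1 \<le> (2 :: nat)" "real 2 * q \<le> \<gamma> + q" using q c by auto
  obtain A where A': "A > 0 \<and> (\<forall>h. (\<forall>m\<ge>1. sep_obs m (c * real m ^ 2) (c * real m ^ (2 - 1)) (h m) \<and>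
        expectation (\<lambda>x. h m (orbit m x)) = 0 \<and>
        (q > 2 \<longrightarrow> expectation (\<lambda>x. (h m (orbit m x))\<^sup>2) \<le> c * real m powr (2 * q / q))) \<longrightarrow>
     (\<forall>k\<ge>1. \<forall>n\<ge>2 * k. let m = n div (2 * k) in
        expectation (\<lambda>x. \<bar>h n (orbit n x) - (\<Sum>i<2 * k. h m (orbit m ((T ^^ (i * m)) x)))\<bar> powr q)
          \<le> E k * real n powr q) \<longrightarrow>
     (\<forall>n\<ge>1. expectation (\<lambda>x. \<bar>h n (orbit n x)\<bar> powr q) \<le> A * real n powr q))"
    using block_moment_bound[OF q', of E] by (rule exE)
  show ?thesis
  proof (rule exI[of _ A], rule conjI[OF conjunct1[OF A']], intro allI impI)
    fix v w and n :: nat assume v: "observable v" and w: "observable w" and n: "n \<ge> 1"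
    note [measurable] = birkhoff_sum_measurable[OF v] birkhoff_sum_measurable[OF w] iterated_sum_measurable[OF v w]
    let ?h = "\<lambda>m X. (\<Sum>j<m. \<Sum>i<j. v (X i) * w (X j)) - expectation (iterated_sum T v w m)"
    have h: "?h m (orbit m x) = centered_sum v w m x" for m x
      by (simp add: iterated_sum_orbit centered_sum_def)
    have "\<forall>n\<ge>1. expectation (\<lambda>x. \<bar>?h n (orbit n x)\<bar> powr q) \<le> A * real n powr q"
    proof ((rule conjunct2[OF A', THEN spec[of _ ?h], THEN mp, THEN mp]; intro allI impI), goal_cases)
      case (1 m)
      have "expectation (centered_sum v w m) = 0"
        unfolding centered_sum_def using integrable_iterated_sum[OF v w] by (simp add: prob_space)
      moreover have "expectation (\<lambda>x. (centered_sum v w m x)\<^sup>2) \<le> c * real m powr (2 * q / q)" if "q > 2"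
      proof -
        have "expectation (\<lambda>x. (centered_sum v w m x)\<^sup>2) \<le> B * (real m)\<^sup>2" by (rule var[OF that v w 1])
        also have "\<dots> \<le> c * (real m)\<^sup>2" using c by (intro mult_right_mono) auto
        finally show ?thesis using q 1 by simp
      qed
      moreover have "sep_obs m (c * real m ^ 2) (c * real m ^ (2 - 1)) (?h m)"
        by (rule sep_obs_iterated[OF v w c(1) abs_expectation_iterated_sum_le[OF v w]])
      ultimately show ?case unfolding h by blast
    next
      case (2 k n)
      define m where "m = n div (2 * k)"
      define s where "s = n mod (2 * k)"
      have n: "n = 2 * k * m + s" and s: "s < 2 * k" using 2 by (simp_all add: m_def s_def)
      define I where "I i x = birkhoff_sum T v (i * m) x * birkhoff_sum T w m ((T ^^ (i * m)) x)" for i x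
      define V where "V x = centered_sum v w n x - (\<Sum>i<2 * k. centered_sum v w m ((T ^^ (i * m)) x))" for x
      have [measurable]: "V \<in> borel_measurable \<mu>" unfolding V_def centered_sum_def by measurable
      have rest: "\<bar>V x - (\<Sum>i<2 * k. I i x)\<bar> \<le> Q k * real n" for x
        unfolding V_def I_def Q_def by (rule centered_block_remainder[OF v w 2(1) n s])
      have im: "m \<le> n" "i * m \<le> n" if "i < 2 * k" for i
      proof -
        have "i * m \<le> 2 * k * m" using that by (intro mult_le_mono) auto
        then show "i * m \<le> n" using n by linarith
      qed (simp add: m_def)
      have I: "integrable \<mu> (\<lambda>x. \<bar>I i x\<bar> powr q)"
        "expectation (\<lambda>x. \<bar>I i x\<bar> powr q) \<le> A1 * real n powr q" if "i < 2 * k" for i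
        using birkhoff_product_moment[OF v w q(1) A1(2) im[OF that] less_imp_le[OF A1(1)]]
        by (simp_all only: I_def)
      have pw: "\<bar>V x\<bar> powr q \<le> 2 powr q * (real (2 * k) powr q * (\<Sum>i<2 * k. \<bar>I i x\<bar> powr q) + (Q k * real n) powr q)" for x
      proof -
        have "\<bar>V x\<bar> powr q = \<bar>(\<Sum>i<2 * k. I i x) + (V x - (\<Sum>i<2 * k. I i x))\<bar> powr q" by simp
        also have "\<dots> \<le> 2 powr q * (\<bar>\<Sum>i<2 * k. I i x\<bar> powr q + \<bar>V x - (\<Sum>i<2 * k. I i x)\<bar> powr q)"
          using q by (intro abs_powr_add_le) auto
        also have "\<dots> \<le> 2 powr q * (real (2 * k) powr q * (\<Sum>i<2 * k. \<bar>I i x\<bar> powr q) + (Q k * real n) powr q)"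
        proof (intro mult_left_mono add_mono)
          show "\<bar>\<Sum>i<2 * k. I i x\<bar> powr q \<le> real (2 * k) powr q * (\<Sum>i<2 * k. \<bar>I i x\<bar> powr q)"
            using abs_powr_sum_le[of "{..<2 * k}" q "\<lambda>i. I i x"] q by simp
          show "\<bar>V x - (\<Sum>i<2 * k. I i x)\<bar> powr q \<le> (Q k * real n) powr q"
            using rest[of x] q by (intro powr_mono2) auto
        qed auto
        finally show ?thesis .
      qed
      have intS: "integrable \<mu> (\<lambda>x. real (2 * k) powr q * (\<Sum>i<2 * k. \<bar>I i x\<bar> powr q))"
        using I(1) by (intro integrable_mult_right Bochner_Integration.integrable_sum) auto
      then have intR: "integrable \<mu> (\<lambda>x. 2 powr q * (real (2 * k) powr q * (\<Sum>i<2 * k. \<bar>I i x\<bar> powr q) + (Q k * real n) powr q))"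
        by (intro integrable_mult_right[OF Bochner_Integration.integrable_add] integrable_const)
      have "expectation (\<lambda>x. \<bar>V x\<bar> powr q)
          \<le> expectation (\<lambda>x. 2 powr q * (real (2 * k) powr q * (\<Sum>i<2 * k. \<bar>I i x\<bar> powr q) + (Q k * real n) powr q))"
        by (rule integral_mono'[OF intR pw])
          (intro mult_nonneg_nonneg add_nonneg_nonneg sum_nonneg powr_ge_zero)
      also have "\<dots> = 2 powr q * (real (2 * k) powr q * (\<Sum>i<2 * k. expectation (\<lambda>x. \<bar>I i x\<bar> powr q)) + (Q k * real n) powr q)"
        using I(1) by (simp add: prob_space Bochner_Integration.integral_add[OF intS] Bochner_Integration.integral_sum del: of_nat_mult)
      also have "\<dots> \<le> 2 powr q * (real (2 * k) powr q * (real (2 * k) * (A1 * real n powr q)) + (Q k * real n) powr q)"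
      proof (intro mult_left_mono add_right_mono)
        have "(\<Sum>i<2 * k. expectation (\<lambda>x. \<bar>I i x\<bar> powr q)) \<le> (\<Sum>i<2 * k. A1 * real n powr q)"
          using I(2) by (intro sum_mono) auto
        then show "(\<Sum>i<2 * k. expectation (\<lambda>x. \<bar>I i x\<bar> powr q)) \<le> real (2 * k) * (A1 * real n powr q)" by simp
      qed auto
      also have "\<dots> = E k * real n powr q"
        using Q0 by (simp add: E_def powr_mult algebra_simps)
      finally show ?case unfolding h m_def[symmetric] Let_def V_def .
    qed
    then show "expectation (\<lambda>x. \<bar>centered_sum v w n x\<bar> powr q) \<le> A * real n powr q"
      using n unfolding h by blast
  qed
qed

lemma centered_moment_rate:
  "\<exists>A>0. \<forall>v w. observable v \<longrightarrow> observable w \<longrightarrow>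
    (\<forall>n\<ge>1. expectation (\<lambda>x. \<bar>centered_sum v w n x\<bar> powr \<gamma>) \<le> A * real n powr \<gamma>)"
proof (cases "\<gamma> > 2")
  case True
  \<comment> \<open>The exponent \<open>2\<close>, which needs no variance bound, provides the variance for \<open>\<gamma>\<close>.\<close>
  then obtain B where B: "B > 0" "\<And>v w n. observable v \<Longrightarrow> observable w \<Longrightarrow> n \<ge> 1 \<Longrightarrow>
    expectation (\<lambda>x. \<bar>centered_sum v w n x\<bar> powr 2) \<le> B * real n powr 2"
    using centered_moment[of 2 0] by auto
  show ?thesis
  proof (rule centered_moment[of _ B])
    fix v w and m :: nat assume "observable v" "observable w" "m \<ge> 1"
    moreover have "\<bar>y\<bar> powr 2 = y\<^sup>2" for y :: real by (cases "y = 0") auto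
    ultimately show "expectation (\<lambda>x. (centered_sum v w m x)\<^sup>2) \<le> B * (real m)\<^sup>2"
      using B(2)[of v w m] by simp
  qed (use B rate in auto)
next
  case False
  then show ?thesis using centered_moment[of \<gamma> 0] rate by auto
qed

text \<open>The mean removed by centring is at most \<open>cov_const * n\<close>, so adding it back
  preserves the order \<open>n powr \<gamma>\<close>.\<close>

lemma iterated_moment:
  "\<exists>A>0. \<forall>v w. observable v \<longrightarrow> observable w \<longrightarrow>
    (\<forall>n\<ge>1. expectation (\<lambda>x. \<bar>iterated_sum T v w n x\<bar> powr \<gamma>) \<le> A * real n powr \<gamma>)"
proof -
  obtain A where A: "A > 0" "\<And>v w n. observable v \<Longrightarrow> observable w \<Longrightarrow> n \<ge> 1 \<Longrightarrow>
    expectation (\<lambda>x. \<bar>centered_sum v w n x\<bar> powr \<gamma>) \<le> A * real n powr \<gamma>"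
    using centered_moment_rate by blast
  show ?thesis
  proof (intro exI[of _ "2 powr \<gamma> * (A + cov_const powr \<gamma>)"] conjI allI impI)
    show "0 < 2 powr \<gamma> * (A + cov_const powr \<gamma>)" using A by (simp add: add_pos_nonneg)
    fix v w and n :: nat assume v: "observable v" and w: "observable w" and n: "n \<ge> 1"
    note [measurable] = iterated_sum_measurable[OF v w]
    have [measurable]: "centered_sum v w n \<in> borel_measurable \<mu>"
      unfolding centered_sum_def by measurable
    have "\<bar>centered_sum v w n x\<bar> \<le> (real n)\<^sup>2 + (real n)\<^sup>2" for x
      unfolding centered_sum_def
      using abs_iterated_sum_le[of v w T n x, OF observableD(2)[OF v] observableD(2)[OF w]]
        abs_expectation_iterated_sum_le[OF v w, of n] by linarith
    then have "\<bar>centered_sum v w n x\<bar> powr \<gamma> \<le> ((real n)\<^sup>2 + (real n)\<^sup>2) powr \<gamma>" for x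
      using rate by (intro powr_mono2) auto
    then have int: "integrable \<mu> (\<lambda>x. \<bar>centered_sum v w n x\<bar> powr \<gamma>)"
      by (intro integrable_bounded[of _ "((real n)\<^sup>2 + (real n)\<^sup>2) powr \<gamma>"]) auto
    have pw: "\<bar>iterated_sum T v w n x\<bar> powr \<gamma>
        \<le> 2 powr \<gamma> * (\<bar>centered_sum v w n x\<bar> powr \<gamma> + cov_const powr \<gamma> * real n powr \<gamma>)" for x
    proof -
      let ?e = "expectation (iterated_sum T v w n)"
      have "\<bar>iterated_sum T v w n x\<bar> powr \<gamma> = \<bar>centered_sum v w n x + ?e\<bar> powr \<gamma>"
        by (simp add: centered_sum_def)
      also have "\<dots> \<le> 2 powr \<gamma> * (\<bar>centered_sum v w n x\<bar> powr \<gamma> + \<bar>?e\<bar> powr \<gamma>)"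
        using rate by (intro abs_powr_add_le) auto
      also have "\<bar>?e\<bar> powr \<gamma> \<le> (cov_const * real n) powr \<gamma>"
        using expectation_iterated_sum[OF v w, of n] rate by (intro powr_mono2) auto
      also have "\<dots> = cov_const powr \<gamma> * real n powr \<gamma>" using cov_const_nonneg by (simp add: powr_mult)
      finally show ?thesis by simp
    qed
    have "expectation (\<lambda>x. \<bar>iterated_sum T v w n x\<bar> powr \<gamma>)
        \<le> expectation (\<lambda>x. 2 powr \<gamma> * (\<bar>centered_sum v w n x\<bar> powr \<gamma> + cov_const powr \<gamma> * real n powr \<gamma>))"
      using int by (intro integral_mono'[OF _ pw]) auto
    also have "\<dots> = 2 powr \<gamma> * (expectation (\<lambda>x. \<bar>centered_sum v w n x\<bar> powr \<gamma>) + cov_const powr \<gamma> * real n powr \<gamma>)"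
      using int by (simp add: prob_space)
    also have "\<dots> \<le> 2 powr \<gamma> * (A * real n powr \<gamma> + cov_const powr \<gamma> * real n powr \<gamma>)"
      using A(2)[OF v w n] by (intro mult_left_mono add_right_mono) auto
    finally show "expectation (\<lambda>x. \<bar>iterated_sum T v w n x\<bar> powr \<gamma>)
        \<le> 2 powr \<gamma> * (A + cov_const powr \<gamma>) * real n powr \<gamma>" by (simp add: algebra_simps)
  qed
qed

end

section \<open>Dynamically Hoelder observables\<close>

text \<open>Integrability excludes the infinite branch of \<open>Lp_norm\<close>; the rest is
  homogeneity, including \<open>H = 0\<close>.\<close>

lemma Lp_norm_scaled_le:
  assumes int: "integrable M (\<lambda>x. \<bar>g x\<bar> powr p)" and le: "(\<integral>x. \<bar>g x\<bar> powr p \<partial>M) \<le> I"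
    and H: "H \<ge> 0" and p: "p > 0" and f: "\<And>x. f x = H * g x"
  shows "Lp_norm M p f \<le> ennreal (H * I powr (1 / p))"
proof -
  let ?E = "\<integral>x. \<bar>g x\<bar> powr p \<partial>M"
  have fg: "\<bar>f x\<bar> powr p = H powr p * \<bar>g x\<bar> powr p" for x
    using H by (simp add: f abs_mult powr_mult)
  have "(\<integral>\<^sup>+x. ennreal (\<bar>f x\<bar> powr p) \<partial>M) = ennreal (H powr p * ?E)"
    unfolding fg using int by (subst nn_integral_eq_integral) auto
  then have "Lp_norm M p f = ennreal ((H powr p * ?E) powr (1 / p))"
    by (simp add: Lp_norm_def Let_def)
  also have "(H powr p * ?E) powr (1 / p) = H * ?E powr (1 / p)"
    using H p by (simp add: powr_mult powr_powr)
  also have "ennreal (H * ?E powr (1 / p)) \<le> ennreal (H * I powr (1 / p))"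
    using le H p by (intro ennreal_leI mult_left_mono powr_mono2) auto
  finally show ?thesis .
qed

lemma epow_nonneg: "\<theta> > 0 \<Longrightarrow> epow \<theta> s n \<ge> 0"
  by (auto simp: epow_def split: enat.split)

section \<open>The Hoelder seminorm as a family of oscillation bounds\<close>

text \<open>The instance of \<open>R\<close>: the third component is the denominator of the
  seminorm, so that a seminorm bound \<open>L\<close> turns into oscillations of at most
  \<open>L * r\<close>.\<close>

definition hoelder_pairs :: "('m \<Rightarrow> 'm) \<Rightarrow> ('m, 'b) tower_data \<Rightarrow> real \<Rightarrow> ('m \<times> 'm \<times> real) set" where
  "hoelder_pairs T D \<theta> = {((T ^^ l) y, (T ^^ l) y', base_dist D y y' + epow \<theta> (base_sep D y y') 0) | l y y'.
     y \<in> base D \<and> y' \<in> base D \<and> y \<noteq> y' \<and> l < ret D y}"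

context
  fixes T :: "'m \<Rightarrow> 'm" and D :: "('m, 'b) tower_data" and \<theta> :: real
  assumes metric: "Metric_space (base D) (base_dist D)" and \<theta>: "\<theta> > 0"
begin

text \<open>Distinct base points have positive distance, so no quotient in the seminorm is a
  division by zero, which would have the value 0 and hide an oscillation.\<close>

lemma hoelder_pair_pos:
  assumes "y \<in> base D" "y' \<in> base D - {y}"
  shows "base_dist D y y' + epow \<theta> (base_sep D y y') 0 > 0"
proof -
  have "base_dist D y y' > 0" using Metric_space.mdist_pos_eq[OF metric, of y y'] assms by auto
  then show ?thesis using epow_nonneg[OF \<theta>, of "base_sep D y y'" 0] by linarith
qed

lemma hoelder_seminorm_le:
  assumes "\<And>z z' r. (z, z', r) \<in> hoelder_pairs T D \<theta> \<Longrightarrow> \<bar>g z - g z'\<bar> \<le> L * r"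
  shows "hoelder_seminorm T D \<theta> g \<le> ennreal L"
  unfolding hoelder_seminorm_def
proof (intro SUP_least ennreal_leI)
  fix y y' l assume y: "y \<in> base D" "y' \<in> base D - {y}" "l \<in> {..<ret D y}"
  then have "\<bar>g ((T ^^ l) y) - g ((T ^^ l) y')\<bar> \<le> L * (base_dist D y y' + epow \<theta> (base_sep D y y') 0)"
    by (intro assms) (auto simp: hoelder_pairs_def)
  then show "\<bar>g ((T ^^ l) y) - g ((T ^^ l) y')\<bar> / (base_dist D y y' + epow \<theta> (base_sep D y y') 0) \<le> L"
    using hoelder_pair_pos[OF y(1,2)] by (simp add: pos_divide_le_eq)
qed

lemma hoelder_seminormD:
  assumes "hoelder_seminorm T D \<theta> g \<le> ennreal L" "L \<ge> 0" "(z, z', r) \<in> hoelder_pairs T D \<theta>"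
  shows "\<bar>g z - g z'\<bar> \<le> L * r"
proof -
  obtain y y' l where y: "y \<in> base D" "y' \<in> base D - {y}" "l \<in> {..<ret D y}"
    and z: "z = (T ^^ l) y" "z' = (T ^^ l) y'" "r = base_dist D y y' + epow \<theta> (base_sep D y y') 0"
    using assms(3) by (auto simp: hoelder_pairs_def)
  have "ennreal (\<bar>g z - g z'\<bar> / r) \<le> hoelder_seminorm T D \<theta> g"
    unfolding hoelder_seminorm_def z
    by (rule SUP_upper2[OF y(1)], rule SUP_upper2[OF y(2)], rule SUP_upper2[OF y(3)], rule order_refl)
  also note assms(1)
  finally have "\<bar>g z - g z'\<bar> / r \<le> L" using assms(2) by simp
  then show ?thesis using hoelder_pair_pos[OF y(1,2)] z by (simp add: pos_divide_le_eq)
qed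

text \<open>One sup bound and \<open>q\<close> seminorms give the shape \<open>B + q * L\<close>
  that the locale assumption \<open>decorrelate\<close> asks for.\<close>

lemma sep_hoelder_norm_le:
  assumes B: "\<And>x. \<bar>G x\<bar> \<le> B" and L0: "L \<ge> 0"
    and L: "\<And>i x z z' r. i < q \<Longrightarrow> (z, z', r) \<in> hoelder_pairs T D \<theta> \<Longrightarrow> \<bar>G (x(i := z)) - G (x(i := z'))\<bar> \<le> L * r"
  shows "sep_hoelder_norm T D \<theta> q G \<le> ennreal (B + real q * L)"
proof -
  have B0: "B \<ge> 0" using B[of undefined] by linarith
  have "sup_norm_on (\<Pi>\<^sub>E j\<in>{..<q}. UNIV) G \<le> ennreal B"
    unfolding sup_norm_on_def using B by (intro SUP_least ennreal_leI)
  moreover have "(\<Sum>i<q. sep_hoelder_seminorm T D \<theta> q G i) \<le> (\<Sum>i<q. ennreal L)"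
    unfolding sep_hoelder_seminorm_def using L by (intro sum_mono SUP_least hoelder_seminorm_le) auto
  moreover have "(\<Sum>i<q. ennreal L) = ennreal (real q * L)"
    using L0 by (simp add: ennreal_mult' flip: ennreal_of_nat_eq_real_of_nat)
  ultimately have "sep_hoelder_norm T D \<theta> q G \<le> ennreal B + ennreal (real q * L)"
    unfolding sep_hoelder_norm_def by (metis add_mono)
  then show ?thesis using B0 L0 by (simp flip: ennreal_plus)
qed

end

section \<open>Passage from normalised observables to arbitrary ones\<close>

theorem theorem2p4:
  fixes \<mu> :: "'m::metric_space measure" and T :: "'m \<Rightarrow> 'm"
    and D :: "('m, 'b) tower_data" and \<theta> \<gamma> :: real
  assumes "\<gamma> > 1"
    and "0 < \<theta>" and "\<theta> < 1"
    and "modelled_by_young_tower \<mu> T D"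
    and "functional_correlation_bound \<mu> T D \<theta> \<gamma>"
  shows "\<exists>C>0. \<forall>n\<ge>1. \<forall>v\<in>mean_zero_hoelder \<mu> T D \<theta>. \<forall>w\<in>mean_zero_hoelder \<mu> T D \<theta>.
    Lp_norm \<mu> (2 * \<gamma>) (birkhoff_sum T v n)
      \<le> ennreal (C * real n powr (1 / 2)) * hoelder_norm T D \<theta> v \<and>
    Lp_norm \<mu> \<gamma> (iterated_sum T v w n)
      \<le> ennreal (C * real n) * hoelder_norm T D \<theta> v * hoelder_norm T D \<theta> w"
proof -
  have prob: "prob_space \<mu>" and sets: "sets \<mu> = sets borel" and erg: "ergodic_mpt \<mu> T"
    and metric: "Metric_space (base D) (base_dist D)"
    using assms(4) by (auto simp: modelled_by_young_tower_def two_sided_gibbs_markov_def)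
  obtain C where C: "C > 0" and fcb: "\<And>p q (n :: nat \<Rightarrow> nat) G. G \<in> sep_hoelder_space \<mu> T D \<theta> q \<Longrightarrow>
      1 \<le> p \<Longrightarrow> p < q \<Longrightarrow> mono_on {..<q} n \<Longrightarrow> n (p - 1) < n p \<Longrightarrow>
      ennreal \<bar>(\<integral>x. G (\<lambda>i\<in>{..<q}. (T ^^ n i) x) \<partial>\<mu>)
               - (\<integral>(x\<^sub>0, x\<^sub>1). G (\<lambda>i\<in>{..<q}. (T ^^ n i) (if i < p then x\<^sub>0 else x\<^sub>1)) \<partial>(\<mu> \<Otimes>\<^sub>M \<mu>))\<bar>
          \<le> ennreal (C * real (n p - n (p - 1)) powr (- \<gamma>)) * sep_hoelder_norm T D \<theta> q G"
    using assms(5) unfolding functional_correlation_bound_def by blast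
  interpret prob_space \<mu> by (rule prob)
  \<comment> \<open>The correlation bound with extended real norms becomes a real inequality for
    observables given with explicit bounds \<open>B\<close> and \<open>L\<close>.\<close>
  interpret decorrelated_map \<mu> T "hoelder_pairs T D \<theta>" \<gamma> C
  proof
    show "space \<mu> = UNIV" using sets_eq_imp_space_eq[OF sets] by simp
    show "T \<in> \<mu> \<rightarrow>\<^sub>M \<mu>" "distr \<mu> \<mu> T = \<mu>" using erg by (auto simp: ergodic_mpt_def preserves_measure_def)
    fix p q and n :: "nat \<Rightarrow> nat" and G B L
    assume pq: "1 \<le> p" "p < q" "mono_on {..<q} n" "n (p - 1) < n p"
      and G: "G \<in> borel_measurable (\<Pi>\<^sub>M j\<in>{..<q}. \<mu>)" and B: "\<And>x. \<bar>G x\<bar> \<le> B" and L0: "L \<ge> 0"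
      and L: "\<And>i x z z' r. i < q \<Longrightarrow> (z, z', r) \<in> hoelder_pairs T D \<theta> \<Longrightarrow> \<bar>G (x(i := z)) - G (x(i := z'))\<bar> \<le> L * r"
    have B0: "B \<ge> 0" using B[of undefined] by linarith
    have norm: "sep_hoelder_norm T D \<theta> q G \<le> ennreal (B + real q * L)"
      by (intro sep_hoelder_norm_le metric assms(2) B L0 L)
    then have "G \<in> sep_hoelder_space \<mu> T D \<theta> q"
      using G by (simp add: sep_hoelder_space_def order_le_less_trans[OF _ ennreal_less_top])
    from fcb[OF this pq] mult_left_mono[OF norm]
    have "ennreal \<bar>(\<integral>x. G (\<lambda>i\<in>{..<q}. (T ^^ n i) x) \<partial>\<mu>)
               - (\<integral>(x\<^sub>0, x\<^sub>1). G (\<lambda>i\<in>{..<q}. (T ^^ n i) (if i < p then x\<^sub>0 else x\<^sub>1)) \<partial>(\<mu> \<Otimes>\<^sub>M \<mu>))\<bar>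
          \<le> ennreal (C * real (n p - n (p - 1)) powr (- \<gamma>)) * ennreal (B + real q * L)"
      by (meson order_trans zero_le)
    also have "\<dots> = ennreal (C * real (n p - n (p - 1)) powr (- \<gamma>) * (B + real q * L))"
      using C B0 L0 by (intro ennreal_mult[symmetric]) auto
    finally show "\<bar>(\<integral>x. G (\<lambda>i\<in>{..<q}. (T ^^ n i) x) \<partial>\<mu>)
               - (\<integral>(x\<^sub>0, x\<^sub>1). G (\<lambda>i\<in>{..<q}. (T ^^ n i) (if i < p then x\<^sub>0 else x\<^sub>1)) \<partial>(\<mu> \<Otimes>\<^sub>M \<mu>))\<bar>
          \<le> C * real (n p - n (p - 1)) powr (- \<gamma>) * (B + real q * L)"
      using C B0 L0 by (subst (asm) ennreal_le_iff) auto
  qed (use C assms in auto)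
  obtain A where A: "A > 0"
    "\<And>v n. observable v \<Longrightarrow> expectation (\<lambda>x. \<bar>birkhoff_sum T v n x\<bar> powr (2 * \<gamma>)) \<le> A * real n powr \<gamma>"
    using birkhoff_moment[OF assms(1) order_refl] by blast
  obtain A' where A': "A' > 0" "\<And>v w n. observable v \<Longrightarrow> observable w \<Longrightarrow> n \<ge> 1 \<Longrightarrow>
     expectation (\<lambda>x. \<bar>iterated_sum T v w n x\<bar> powr \<gamma>) \<le> A' * real n powr \<gamma>"
    using iterated_moment by blast
  \<comment> \<open>Roots of the two moment constants, added so that one constant serves (a) and
    (b).\<close>
  define c where "c = A powr (1 / (2 * \<gamma>)) + A' powr (1 / \<gamma>)"
  have c: "A powr (1 / (2 * \<gamma>)) \<le> c" "A' powr (1 / \<gamma>) \<le> c" "c > 0"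
    using A A' by (auto simp: c_def add_pos_nonneg)
  \<comment> \<open>Birkhoff sums are linear and iterated sums bilinear, so the norms split off by
    this normalisation return as the factors in (a) and (b).\<close>
  have normalize: "\<exists>H u. H \<ge> 0 \<and> hoelder_norm T D \<theta> v = ennreal H \<and> observable u \<and> (\<forall>x. v x = H * u x)"
    if "v \<in> mean_zero_hoelder \<mu> T D \<theta>" for v
  proof -
    have v: "v \<in> borel_measurable \<mu>" "hoelder_norm T D \<theta> v < \<infinity>" "expectation v = 0"
      using that by (auto simp: mean_zero_hoelder_def hoelder_space_def)
    define H where "H = enn2real (hoelder_norm T D \<theta> v)"
    have H: "H \<ge> 0" "hoelder_norm T D \<theta> v = ennreal H" using v(2) by (auto simp: H_def)
    have "ennreal \<bar>v x\<bar> \<le> hoelder_norm T D \<theta> v" for x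
      unfolding hoelder_norm_def sup_norm_on_def by (intro add_increasing2 SUP_upper) auto
    then have vH: "\<bar>v x\<bar> \<le> H" for x using H by (simp add: H(2))
    have "hoelder_seminorm T D \<theta> v \<le> ennreal H"
      unfolding H(2)[symmetric] hoelder_norm_def by simp
    note vL = hoelder_seminormD[OF metric assms(2) this H(1)]
    \<comment> \<open>For \<open>H = 0\<close> both \<open>v\<close> and \<open>v / H\<close> vanish.\<close>
    have "observable (\<lambda>x. v x / H)"
      unfolding observable_def
    proof (intro conjI allI ballI)
      show "(\<lambda>x. v x / H) \<in> borel_measurable \<mu>" using v(1) by measurable
      show "\<bar>v x / H\<bar> \<le> 1" for x using vH[of x] H(1) by (cases "H = 0") (auto simp: divide_simps)
      show "expectation (\<lambda>x. v x / H) = 0" using v(3) by simp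
      fix t assume "t \<in> hoelder_pairs T D \<theta>"
      moreover obtain z z' r where "t = (z, z', r)" by (cases t) auto
      ultimately have t: "t = (z, z', r)" "(z, z', r) \<in> hoelder_pairs T D \<theta>" by auto
      have "0 < r" using t(2) hoelder_pair_pos[OF metric assms(2)] by (auto simp: hoelder_pairs_def)
      then have "\<bar>v z / H - v z' / H\<bar> \<le> r"
        using vL[OF t(2)] H(1) by (cases "H = 0") (auto simp: divide_simps mult.commute simp flip: diff_divide_distrib)
      then show "case t of (z, z', r) \<Rightarrow> \<bar>v z / H - v z' / H\<bar> \<le> r" by (simp add: t)
    qed
    moreover have "v x = H * (v x / H)" for x using vH[of x] by (cases "H = 0") auto
    ultimately show ?thesis using H by blast
  qed
  show ?thesis
  proof (rule exI[of _ c], rule conjI[OF c(3)], intro allI impI ballI conjI)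
    fix n :: nat and v w
    assume n: "n \<ge> 1" and "v \<in> mean_zero_hoelder \<mu> T D \<theta>" "w \<in> mean_zero_hoelder \<mu> T D \<theta>"
    then obtain H H' u u' where H: "H \<ge> 0" "hoelder_norm T D \<theta> v = ennreal H" "observable u" "\<And>x. v x = H * u x"
      and H': "H' \<ge> 0" "hoelder_norm T D \<theta> w = ennreal H'" "observable u'" "\<And>x. w x = H' * u' x"
      using normalize by metis
    note [measurable] = birkhoff_sum_measurable[OF H(3)] iterated_sum_measurable[OF H(3) H'(3)]
    have "\<bar>birkhoff_sum T u n x\<bar> powr (2 * \<gamma>) \<le> real n powr (2 * \<gamma>)" for x
      using abs_birkhoff_sum_le[of u T n x, OF observableD(2)[OF H(3)]] assms(1) by (intro powr_mono2) auto
    then have int: "integrable \<mu> (\<lambda>x. \<bar>birkhoff_sum T u n x\<bar> powr (2 * \<gamma>))"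
      by (intro integrable_bounded[of _ "real n powr (2 * \<gamma>)"]) auto
    have "Lp_norm \<mu> (2 * \<gamma>) (birkhoff_sum T v n) \<le> ennreal (H * (A * real n powr \<gamma>) powr (1 / (2 * \<gamma>)))"
      using assms(1) by (intro Lp_norm_scaled_le[OF int A(2)[OF H(3)] H(1)])
        (simp_all add: birkhoff_sum_def H(4) sum_distrib_left)
    also have "(A * real n powr \<gamma>) powr (1 / (2 * \<gamma>)) = A powr (1 / (2 * \<gamma>)) * real n powr (1 / 2)"
      using A assms(1) by (simp add: powr_mult powr_powr)
    also have "ennreal (H * (A powr (1 / (2 * \<gamma>)) * real n powr (1 / 2))) \<le> ennreal (H * (c * real n powr (1 / 2)))"
      using H c by (intro ennreal_leI mult_left_mono mult_right_mono) auto
    also have "\<dots> = ennreal (c * real n powr (1 / 2)) * hoelder_norm T D \<theta> v"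
      using H c by (simp add: mult.commute flip: ennreal_mult)
    finally show "Lp_norm \<mu> (2 * \<gamma>) (birkhoff_sum T v n) \<le> ennreal (c * real n powr (1 / 2)) * hoelder_norm T D \<theta> v" .
    have "\<bar>iterated_sum T u u' n x\<bar> powr \<gamma> \<le> ((real n)\<^sup>2) powr \<gamma>" for x
      using abs_iterated_sum_le[of u u' T n x, OF observableD(2)[OF H(3)] observableD(2)[OF H'(3)]] assms(1)
      by (intro powr_mono2) auto
    then have int': "integrable \<mu> (\<lambda>x. \<bar>iterated_sum T u u' n x\<bar> powr \<gamma>)"
      by (intro integrable_bounded[of _ "((real n)\<^sup>2) powr \<gamma>"]) auto
    have "Lp_norm \<mu> \<gamma> (iterated_sum T v w n) \<le> ennreal (H * H' * (A' * real n powr \<gamma>) powr (1 / \<gamma>))"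
      using assms(1) H(1) H'(1)
      by (intro Lp_norm_scaled_le[OF int' A'(2)[OF H(3) H'(3) n]])
        (simp_all add: iterated_sum_eq H(4) H'(4) sum_distrib_left mult_ac)
    also have "(A' * real n powr \<gamma>) powr (1 / \<gamma>) = A' powr (1 / \<gamma>) * real n"
      using A' assms(1) by (simp add: powr_mult powr_powr)
    also have "ennreal (H * H' * (A' powr (1 / \<gamma>) * real n)) \<le> ennreal (H * H' * (c * real n))"
      using H(1) H'(1) c by (intro ennreal_leI mult_left_mono mult_right_mono) auto
    also have "\<dots> = ennreal (c * real n) * hoelder_norm T D \<theta> v * hoelder_norm T D \<theta> w"
      using H H' c by (simp add: mult_ac flip: ennreal_mult)
    finally show "Lp_norm \<mu> \<gamma> (iterated_sum T v w n)
      \<le> ennreal (c * real n) * hoelder_norm T D \<theta> v * hoelder_norm T D \<theta> w" .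
  qed
qed

end
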